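(* Let $k\ge 2$ be an integer. Let $D$ denote the steady-state sojourn time of an $M/G/1$ queue with arrival rate $\lambda>0$, service time $S$ with distribution function $F$, load $\rho=\lambda\mathbb{E}[S]<1$ and slack parameter $\varepsilon=1-\rho$, and let $Z\sim\mathrm{Exp}(\mu)$, $\mu>0$. Suppose that (i) the distribution of $S$ has a density $g$ with $\lim_{y\to\infty}g(y)=0$; (ii) $\int_0^\infty |y^k(g'(y)+\mu g(y))|\,dy$ is bounded by a constant $C_1$; (iii) $\mathbb{E}[S^i]=\mathbb{E}[Z^i]$ for all integers $i=1,2,\ldots,k+1$. Then $$d_{Zol,k}(\varepsilon D,Z)\le C_2\,\varepsilon^k,\qquad C_2=\frac{1}{\mu\,k!}C_1+2\left(\sum_{j=1}^{2^{k-1}} b_{k,j}\int_0^\infty s^{d_{k,j}}\,dF(s)\right),$$ where the constants $b_{k,j}$ and $d_{k,j}$ ($1\le j\le 2^{k-1}$), which satisfy $3\le d_{k,j}\le k+2$, are the explicit ones defined recursively in the context.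
   Context: $M/G/1$ queue: first-come-first-served single server with infinite buffer, Poisson arrivals of rate $\lambda$, i.i.d. nonnegative service times distributed as $S$ (independent of arrivals). $W$ is the steady-state waiting time (time in the system before service begins), and the sojourn time is the waiting time plus the task's own service time; in steady state $D=W+S$ in law, with $W$ and $S$ independent. The density $g$ is supported on $[0,\infty)$ and is differentiable on $(0,\infty)$. Zolotarev distance of order $k$: for real random variables $X,Y$, $d_{Zol,k}(X,Y)=\sup_{\|h^{(k)}\|\le 1}|\mathbb{E}[h(X)]-\mathbb{E}[h(Y)]|$, where the supremum is over $k$-times differentiable $h:\mathbb{R}\to\mathbb{R}$ whose $k$-th derivative has sup-norm at most $1$. $\mathrm{Exp}(\mu)$ is the exponential distribution with mean $1/\mu$, so $\mathbb{E}[Z^i]=i!/\mu^i$. Constants: $b_{2,1}=\lambda/6$, $d_{2,1}=3$, $b_{2,2}=\lambda\mu/24$, $d_{2,2}=4$. For $k\ge3$: $b_{k,1}=\frac{\lambda\mu}{(k+2)!}$, $d_{k,1}=k+2$; $b_{k,2}=\frac{\lambda}{6\mu^{k-2}}$, $d_{k,2}=3$; and for $3\le r\le k$ and $1\le i\le 2^{r-2}$, $b_{k,2^{r-2}+i}=\frac{b_{r-1,i}}{\mu^{k-r+1}}$ and $d_{k,2^{r-2}+i}=d_{r-1,i}$. If one of the integrals in $C_2$ is infinite, $C_2=+\infty$ and the bound is trivial. *)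

theory Defs
  imports "HOL-Probability.Probability" "HOL-Library.Discrete_Functions"
begin

section \<open>The M/G/1 queue\<close>

text \<open>
  Pathwise dynamics of the first-come-first-served single server with infinite buffer, which is
  empty at time 0: customer \<open>n\<close> arrives at time \<open>a n\<close>, brings work \<open>s n\<close>, and begins service at its
  arrival or at the departure of its predecessor, whichever is later.
\<close>

fun fcfs_departure :: "(nat \<Rightarrow> real) \<Rightarrow> (nat \<Rightarrow> real) \<Rightarrow> nat \<Rightarrow> real" where
  "fcfs_departure a s 0 = a 0 + s 0"
| "fcfs_departure a s (Suc n) = max (a (Suc n)) (fcfs_departure a s n) + s (Suc n)"

definition fcfs_waiting :: "(nat \<Rightarrow> real) \<Rightarrow> (nat \<Rightarrow> real) \<Rightarrow> nat \<Rightarrow> real" where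
  "fcfs_waiting a s n = fcfs_departure a s n - s n - a n"

definition fcfs_sojourn :: "(nat \<Rightarrow> real) \<Rightarrow> (nat \<Rightarrow> real) \<Rightarrow> nat \<Rightarrow> real" where
  "fcfs_sojourn a s n = fcfs_departure a s n - a n"

lemma fcfs_sojourn_eq: "fcfs_sojourn a s n = fcfs_waiting a s n + s n"
  by (simp add: fcfs_sojourn_def fcfs_waiting_def)

lemma fcfs_waiting_0: "fcfs_waiting a s 0 = 0"
  by (simp add: fcfs_waiting_def)

lemma fcfs_waiting_Suc:
  "fcfs_waiting a s (Suc n) = max 0 (fcfs_sojourn a s n - (a (Suc n) - a n))"
  by (simp add: fcfs_waiting_def fcfs_sojourn_def max_def)

text \<open>
  \<open>T n\<close> are the interarrival times and \<open>S n\<close> the service times. The Poisson arrival process of rate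
  \<open>lam\<close> is given by its independent exponential interarrival times. The index type \<^typ>\<open>nat + nat\<close>
  expresses that all the \<open>T n\<close> and \<open>S n\<close> together form one independent family.
\<close>

locale mg1_queue = prob_space M
  for M :: "'a measure" and lam :: real and T S :: "nat \<Rightarrow> 'a \<Rightarrow> real" +
  assumes lam_pos: "0 < lam"
    and interarrival: "\<And>n. distributed M lborel (T n) (exponential_density lam)"
    and service_measurable: "\<And>n. S n \<in> borel_measurable M"
    and service_nonneg: "\<And>n. AE x in M. 0 \<le> S n x"
    and service_identical: "\<And>n. distr M borel (S n) = distr M borel (S 0)"
    and independent: "indep_vars (\<lambda>_. borel) (case_sum T S) UNIV"

definition arrival_time :: "(nat \<Rightarrow> 'a \<Rightarrow> real) \<Rightarrow> nat \<Rightarrow> 'a \<Rightarrow> real" where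
  "arrival_time T n x = (\<Sum>i\<le>n. T i x)"

definition sojourn_time ::
    "(nat \<Rightarrow> 'a \<Rightarrow> real) \<Rightarrow> (nat \<Rightarrow> 'a \<Rightarrow> real) \<Rightarrow> nat \<Rightarrow> 'a \<Rightarrow> real" where
  "sojourn_time T S n x = fcfs_sojourn (\<lambda>i. arrival_time T i x) (\<lambda>i. S i x) n"

text \<open>
  A random variable \<open>D\<close>, possibly on another probability space, has the steady-state sojourn time
  distribution if the sojourn time of the \<open>n\<close>-th customer converges to it in law.
\<close>

definition steady_state_sojourn ::
    "'a measure \<Rightarrow> (nat \<Rightarrow> 'a \<Rightarrow> real) \<Rightarrow> (nat \<Rightarrow> 'a \<Rightarrow> real) \<Rightarrow> 'b measure \<Rightarrow> ('b \<Rightarrow> real) \<Rightarrow> bool" where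
  "steady_state_sojourn M T S N D \<longleftrightarrow>
     prob_space N \<and> D \<in> borel_measurable N \<and>
     weak_conv_m (\<lambda>n. distr M borel (sojourn_time T S n)) (distr N borel D)"


section \<open>Zolotarev distance\<close>

definition zolotarev_test :: "nat \<Rightarrow> (real \<Rightarrow> real) set" where
  "zolotarev_test k = {h. (\<forall>i<k. \<forall>x. (deriv ^^ i) h differentiable (at x)) \<and>
                          (\<forall>x. \<bar>(deriv ^^ k) h x\<bar> \<le> 1)}"

text \<open>
  A test function grows at most like \<open>\<bar>x\<bar>\<^sup>k\<close>, so the expectations exist whenever both variables have a
  finite absolute \<open>k\<close>-th moment. The distance is meaningful only in that case, because a Bochner
  integral that does not exist has the value 0. The value may be infinite.
\<close>

definition zolotarev_dist ::
    "nat \<Rightarrow> 'a measure \<Rightarrow> ('a \<Rightarrow> real) \<Rightarrow> 'b measure \<Rightarrow> ('b \<Rightarrow> real) \<Rightarrow> ennreal" where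
  "zolotarev_dist k M X N Y =
     (SUP h\<in>zolotarev_test k. ennreal \<bar>(\<integral>x. h (X x) \<partial>M) - (\<integral>y. h (Y y) \<partial>N)\<bar>)"


section \<open>The coefficients of the bound\<close>

text \<open>
  The constants \<open>b\<^bsub>k,j\<^esub>\<close> and \<open>d\<^bsub>k,j\<^esub>\<close> matter for \<open>k \<ge> 2\<close> and \<open>1 \<le> j \<le> 2\<^bsup>k-1\<^esup>\<close>. An index
  \<open>3 \<le> j \<le> 2\<^bsup>k-1\<^esup>\<close> is uniquely \<open>j = 2\<^bsup>m\<^esup> + i\<close> with \<open>1 \<le> m\<close> and \<open>1 \<le> i \<le> 2\<^bsup>m\<^esup>\<close>, namely for
  \<open>m = floor_log (j - 1)\<close>; the recursion is usually stated in terms of \<open>r = m + 2\<close>, as in the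
  lemmas \<open>bcoeff_rec\<close> and \<open>dcoeff_rec\<close> below.
\<close>

function bcoeff :: "real \<Rightarrow> real \<Rightarrow> nat \<Rightarrow> nat \<Rightarrow> real" where
  "bcoeff lam mu k j =
     (if j \<le> 1 then (if k = 2 then lam / 6 else lam * mu / fact (k + 2))
      else if j = 2 then (if k = 2 then lam * mu / 24 else lam / (6 * mu ^ (k - 2)))
      else let m = floor_log (j - 1) in bcoeff lam mu (m + 1) (j - 2 ^ m) / mu ^ (k - (m + 1)))"
  by pat_completeness auto
termination
  by (relation "Wellfounded.measure (\<lambda>(_, _, _, j). j)") auto

function dcoeff :: "nat \<Rightarrow> nat \<Rightarrow> nat" where
  "dcoeff k j =
     (if j \<le> 1 then (if k = 2 then 3 else k + 2)
      else if j = 2 then (if k = 2 then 4 else 3)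
      else let m = floor_log (j - 1) in dcoeff (m + 1) (j - 2 ^ m))"
  by pat_completeness auto
termination
  by (relation "Wellfounded.measure (\<lambda>(_, j). j)") auto

declare bcoeff.simps [simp del] dcoeff.simps [simp del]

lemma bcoeff_base:
  "bcoeff lam mu 2 1 = lam / 6"
  "bcoeff lam mu 2 2 = lam * mu / 24"
  "k \<ge> 3 \<Longrightarrow> bcoeff lam mu k 1 = lam * mu / fact (k + 2)"
  "k \<ge> 3 \<Longrightarrow> bcoeff lam mu k 2 = lam / (6 * mu ^ (k - 2))"
  by (simp_all add: bcoeff.simps)

lemma dcoeff_base:
  "dcoeff 2 1 = 3"
  "dcoeff 2 2 = 4"
  "k \<ge> 3 \<Longrightarrow> dcoeff k 1 = k + 2"
  "k \<ge> 3 \<Longrightarrow> dcoeff k 2 = 3"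
  by (simp_all add: dcoeff.simps)

lemma floor_log_block:
  assumes "1 \<le> i" "i \<le> 2 ^ m"
  shows "floor_log (2 ^ m + i - 1) = m"
  using assms by (intro floor_log_eqI) auto

lemma bcoeff_rec:
  assumes "3 \<le> r" "r \<le> k" "1 \<le> i" "i \<le> 2 ^ (r - 2)"
  shows "bcoeff lam mu k (2 ^ (r - 2) + i) = bcoeff lam mu (r - 1) i / mu ^ (k - r + 1)"
proof -
  have "(2::nat) ^ 1 \<le> 2 ^ (r - 2)"
    using assms by (intro power_increasing) auto
  then have "\<not> 2 ^ (r - 2) + i \<le> 1" "2 ^ (r - 2) + i \<noteq> 2"
    using assms by auto
  moreover have "r - 2 + 1 = r - 1" "k - (r - 1) = k - r + 1"
    using assms by auto
  ultimately show ?thesis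
    using floor_log_block[OF assms(3,4)]
    by (subst bcoeff.simps) (simp only: Let_def if_False add_diff_cancel_left')
qed

lemma dcoeff_rec:
  assumes "3 \<le> r" "r \<le> k" "1 \<le> i" "i \<le> 2 ^ (r - 2)"
  shows "dcoeff k (2 ^ (r - 2) + i) = dcoeff (r - 1) i"
proof -
  have "(2::nat) ^ 1 \<le> 2 ^ (r - 2)"
    using assms by (intro power_increasing) auto
  then have "\<not> 2 ^ (r - 2) + i \<le> 1" "2 ^ (r - 2) + i \<noteq> 2"
    using assms by auto
  moreover have "r - 2 + 1 = r - 1"
    using assms by auto
  ultimately show ?thesis
    using floor_log_block[OF assms(3,4)]
    by (subst dcoeff.simps) (simp only: Let_def if_False add_diff_cancel_left')
qed

end

theory Submission
  imports Defs "HOL-Real_Asymp.Real_Asymp"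
begin

text \<open>
  Write \<open>W\<close> for the stationary waiting time, so that \<open>D = W + S\<close> and \<open>W = max 0 (D - T)\<close> in law, and put
  \<open>f x = h (\<epsilon> x)\<close>, \<open>m x = E f (x + Z / \<epsilon>)\<close>, \<open>n x = E f (x + Z)\<close> and \<open>K' = m\<close>. Averages over an exponential
  law solve the first-order equation \<open>y' = \<nu> (y - f)\<close>, which gives
  \<open>E K (x + Z) = K x + (m x - \<epsilon> n x) / \<lambda>\<close>. The balance equation
  \<open>\<lambda> (E K D - E K W) = E m W - \<epsilon> m 0\<close> of the workload process then yields the exact identity
  \<open>E f D - E h Z = (E f (W + S) - E f (W + Z)) + (\<lambda> / \<epsilon>) (E K (W + S) - E K (W + Z))\<close>. Conditionally on \<open>W\<close>,
  the second difference is bounded by Taylor's formula of order \<open>k + 2\<close>, since \<open>S\<close> and \<open>Z\<close> share \<open>k + 1\<close>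
  moments; the first one is integrated by parts against the density \<open>g\<close> after subtracting a Taylor polynomial
  of degree \<open>k - 1\<close>, which leaves \<open>g' + \<mu> g\<close>.
\<close>

section \<open>Derivatives and polynomial growth\<close>

text \<open>The power of \<open>\<epsilon>\<close> arises as follows. The \<open>k\<close>-th
  derivative of \<open>f\<close> is at most \<open>\<epsilon> ^ k\<close>. \<open>K\<close> has two
  derivatives more than \<open>f\<close>: one because it is an antiderivative, one because the
  equation for \<open>m\<close> can be differentiated up to order \<open>k\<close>. The last one
  carries the factor \<open>mu * \<epsilon>\<close>, which cancels the \<open>1 / \<epsilon>\<close>
  in front of the second difference. Two obstacles shape the proof. \<open>D\<close> is known only
  as a weak limit, so the fixed-point equation for its law has to be recovered from the recursion,
  by characteristic functions. And \<open>K\<close> grows with degree \<open>k + 1\<close>, so the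
  balance equation presupposes that moment of \<open>W\<close>; a drift argument derives it from the
  moment of \<open>S\<close> of order \<open>k + 2\<close>, whose divergence makes the bound
  trivial. The coefficients of orders \<open>k + 2\<close> and \<open>3\<close> come from the two
  Taylor remainders: \<open>S\<close> contributes its own moment of order \<open>k + 2\<close>,
  while that of \<open>Z\<close> is \<open>(k + 2)! / mu ^ (k + 2)\<close>, a number that is
  rewritten as a multiple of \<open>E S ^ 3 = 6 / mu ^ 3\<close>.\<close>

lemma borel_measurable_derivative_on:
  fixes f f' :: "real \<Rightarrow> real"
  assumes [measurable]: "f \<in> borel_measurable borel" "A \<in> sets borel"
    and f': "\<And>x. x \<in> A \<Longrightarrow> (f has_real_derivative f' x) (at x)"
  shows "(\<lambda>x. indicator A x * f' x) \<in> borel_measurable borel"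
proof (rule borel_measurable_LIMSEQ_real)
  \<comment> \<open>Difference quotients along \<open>1 / Suc n\<close>. The indicator confines the
    convergence to \<open>A\<close>, since the derivative of the service density is controlled on
    \<open>{0<..}\<close> only.\<close>
  let ?d = "\<lambda>n x. indicator A x * ((f (x + 1 / Suc n) - f x) / (1 / Suc n))"
  show "?d n \<in> borel_measurable borel" for n
    by measurable
  show "(\<lambda>n. ?d n x) \<longlonglongrightarrow> indicator A x * f' x" for x
  proof (cases "x \<in> A")
    case True
    have lim: "filterlim (\<lambda>n. 1 / real (Suc n)) (at 0) sequentially"
      unfolding filterlim_at using LIMSEQ_inverse_real_of_nat by (auto simp: inverse_eq_divide)
    have "((\<lambda>h. (f (x + h) - f x) / h) \<longlongrightarrow> f' x) (at 0)"
      using f'[OF True] by (simp add: DERIV_def)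
    from filterlim_compose[OF this lim] show ?thesis
      using True by simp
  qed simp
qed

text \<open>The base \<open>1 + \<bar>x\<bar>\<close> is at least \<open>1\<close> and satisfies
  \<open>1 + \<bar>x + t\<bar> \<le> (1 + \<bar>x\<bar>) * (1 + \<bar>t\<bar>)\<close>, so the class
  grows with \<open>p\<close> and a translation only changes the constant.\<close>

definition poly_bounded :: "nat \<Rightarrow> (real \<Rightarrow> real) \<Rightarrow> bool" where
  "poly_bounded p f \<longleftrightarrow> (\<exists>C\<ge>0. \<forall>x. \<bar>f x\<bar> \<le> C * (1 + \<bar>x\<bar>) ^ p)"

lemma poly_bounded_mono:
  assumes "poly_bounded p f" "p \<le> q"
  shows "poly_bounded q f"
proof -
  obtain C where C: "C \<ge> 0" "\<And>x. \<bar>f x\<bar> \<le> C * (1 + \<bar>x\<bar>) ^ p"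
    using assms(1) by (auto simp: poly_bounded_def)
  have "\<bar>f x\<bar> \<le> C * (1 + \<bar>x\<bar>) ^ q" for x
    using C(2)[of x] mult_left_mono[OF power_increasing[OF assms(2), of "1 + \<bar>x\<bar>"] C(1)] by auto
  with C(1) show ?thesis
    by (auto simp: poly_bounded_def)
qed

lemma poly_bounded_add:
  assumes "poly_bounded p f" "poly_bounded p g"
  shows "poly_bounded p (\<lambda>x. f x + g x)"
proof -
  obtain C where C: "C \<ge> 0" "\<And>x. \<bar>f x\<bar> \<le> C * (1 + \<bar>x\<bar>) ^ p"
    using assms(1) by (auto simp: poly_bounded_def)
  obtain D where D: "D \<ge> 0" "\<And>x. \<bar>g x\<bar> \<le> D * (1 + \<bar>x\<bar>) ^ p"
    using assms(2) by (auto simp: poly_bounded_def)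
  have "\<bar>f x + g x\<bar> \<le> (C + D) * (1 + \<bar>x\<bar>) ^ p" for x
    using C(2)[of x] D(2)[of x] by (simp add: distrib_right)
  with C(1) D(1) show ?thesis
    unfolding poly_bounded_def by (intro exI[of _ "C + D"]) auto
qed

lemma poly_bounded_cmult:
  assumes "poly_bounded p f"
  shows "poly_bounded p (\<lambda>x. c * f x)"
proof -
  obtain C where C: "C \<ge> 0" "\<And>x. \<bar>f x\<bar> \<le> C * (1 + \<bar>x\<bar>) ^ p"
    using assms(1) by (auto simp: poly_bounded_def)
  have "\<bar>c * f x\<bar> \<le> (\<bar>c\<bar> * C) * (1 + \<bar>x\<bar>) ^ p" for x
    using mult_left_mono[OF C(2)[of x], of "\<bar>c\<bar>"] by (simp add: abs_mult mult.assoc)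
  with C(1) show ?thesis
    unfolding poly_bounded_def by (intro exI[of _ "\<bar>c\<bar> * C"]) auto
qed

lemma poly_bounded_antiderivative:
  assumes "poly_bounded p f'" "\<And>x. (f has_real_derivative f' x) (at x)"
  shows "poly_bounded (Suc p) f"
proof -
  obtain C where C: "C \<ge> 0" "\<And>x. \<bar>f' x\<bar> \<le> C * (1 + \<bar>x\<bar>) ^ p"
    using assms(1) by (auto simp: poly_bounded_def)
  have "\<bar>f x\<bar> \<le> (\<bar>f 0\<bar> + C) * (1 + \<bar>x\<bar>) ^ Suc p" for x
  proof -
    have "norm (f x - f 0) \<le> C * (1 + \<bar>x\<bar>) ^ p * norm (x - 0)"
    proof (rule field_differentiable_bound[where S = "cball 0 \<bar>x\<bar>" and f' = f'])
      show "norm (f' z) \<le> C * (1 + \<bar>x\<bar>) ^ p" if "z \<in> cball 0 \<bar>x\<bar>" for z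
        using C(2)[of z] that mult_left_mono[OF power_mono[of "1 + \<bar>z\<bar>" "1 + \<bar>x\<bar>" p] C(1)]
        by (auto simp: dist_real_def)
    qed (use assms(2) in \<open>auto intro: has_field_derivative_at_within\<close>)
    also have "\<dots> \<le> C * (1 + \<bar>x\<bar>) ^ p * (1 + \<bar>x\<bar>)"
      using C(1) by (intro mult_left_mono) auto
    finally have 1: "\<bar>f x - f 0\<bar> \<le> C * (1 + \<bar>x\<bar>) ^ Suc p"
      by (simp add: mult_ac)
    have "\<bar>f 0\<bar> * 1 \<le> \<bar>f 0\<bar> * (1 + \<bar>x\<bar>) ^ Suc p"
      by (intro mult_left_mono one_le_power) auto
    with 1 show ?thesis
      unfolding distrib_right by linarith
  qed
  with C(1) show ?thesis
    unfolding poly_bounded_def by (intro exI[of _ "\<bar>f 0\<bar> + C"]) auto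
qed

lemma has_real_derivative_shift:
  fixes f :: "real \<Rightarrow> real"
  assumes "\<And>x. (f has_real_derivative f' x) (at x)"
  shows "((\<lambda>t. f (x + t)) has_real_derivative f' (x + t)) (at t)"
proof -
  have "((\<lambda>t. x + t) has_real_derivative 1) (at t)"
    by (auto intro!: derivative_eq_intros)
  from DERIV_chain2[OF assms this] show ?thesis
    by simp
qed

text \<open>The free point \<open>y\<close> covers both the translate \<open>x + t\<close> and the
  reflected value \<open>max 0 (d - t)\<close>.\<close>

lemma poly_bounded_le:
  assumes "poly_bounded p f"
  obtains C where "C \<ge> 0" "\<And>x t y. \<bar>y\<bar> \<le> \<bar>x\<bar> + \<bar>t\<bar> \<Longrightarrow> \<bar>f y\<bar> \<le> C * ((1 + \<bar>x\<bar>) ^ p * (1 + \<bar>t\<bar>) ^ p)"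
proof -
  obtain C where C: "C \<ge> 0" "\<And>x. \<bar>f x\<bar> \<le> C * (1 + \<bar>x\<bar>) ^ p"
    using assms(1) by (auto simp: poly_bounded_def)
  have "\<bar>f y\<bar> \<le> C * ((1 + \<bar>x\<bar>) ^ p * (1 + \<bar>t\<bar>) ^ p)" if "\<bar>y\<bar> \<le> \<bar>x\<bar> + \<bar>t\<bar>" for x t y
  proof -
    have "1 + \<bar>y\<bar> \<le> (1 + \<bar>x\<bar>) * (1 + \<bar>t\<bar>)"
      using that mult_nonneg_nonneg[of "\<bar>x\<bar>" "\<bar>t\<bar>"] unfolding distrib_left distrib_right by linarith
    then have "(1 + \<bar>y\<bar>) ^ p \<le> ((1 + \<bar>x\<bar>) * (1 + \<bar>t\<bar>)) ^ p"
      by (intro power_mono) auto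
    then have "C * (1 + \<bar>y\<bar>) ^ p \<le> C * ((1 + \<bar>x\<bar>) * (1 + \<bar>t\<bar>)) ^ p"
      using C(1) by (rule mult_left_mono)
    with C(2)[of y] show ?thesis
      by (simp add: power_mult_distrib)
  qed
  with C(1) show ?thesis
    using that by blast
qed

lemma poly_bounded_addD:
  assumes "poly_bounded p f"
  obtains C where "C \<ge> 0" "\<And>x t. \<bar>f (x + t)\<bar> \<le> C * (1 + \<bar>x\<bar>) ^ p * (1 + \<bar>t\<bar>) ^ p"
proof -
  obtain C where C: "C \<ge> 0" "\<And>x t y. \<bar>y\<bar> \<le> \<bar>x\<bar> + \<bar>t\<bar> \<Longrightarrow> \<bar>f y\<bar> \<le> C * ((1 + \<bar>x\<bar>) ^ p * (1 + \<bar>t\<bar>) ^ p)"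
    using poly_bounded_le[OF assms] by blast
  show ?thesis
    by (rule that[OF C(1)]) (simp only: mult.assoc C(2) abs_triangle_ineq)
qed

lemma poly_bounded_shift:
  assumes "poly_bounded p f"
  shows "poly_bounded p (\<lambda>t. f (x + t))"
proof -
  obtain C where C: "C \<ge> 0" "\<And>x t. \<bar>f (x + t)\<bar> \<le> C * (1 + \<bar>x\<bar>) ^ p * (1 + \<bar>t\<bar>) ^ p"
    using poly_bounded_addD[OF assms] by blast
  then show ?thesis
    unfolding poly_bounded_def by (intro exI[of _ "C * (1 + \<bar>x\<bar>) ^ p"]) auto
qed

lemma poly_bounded_exp_decay:
  assumes "poly_bounded p f" "0 < nu"
  shows "((\<lambda>t. exp (- nu * t) * f t) \<longlongrightarrow> 0) at_top"
proof -
  obtain C where C: "C \<ge> 0" "\<And>x. \<bar>f x\<bar> \<le> C * (1 + \<bar>x\<bar>) ^ p"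
    using assms(1) by (auto simp: poly_bounded_def)
  have lim: "((\<lambda>t. C * (exp (- nu * t) * (1 + t) ^ p)) \<longlongrightarrow> C * 0) at_top"
  proof (rule tendsto_mult_left)
    show "((\<lambda>t. exp (- nu * t) * (1 + t) ^ p) \<longlongrightarrow> 0) at_top"
      using assms(2) by real_asymp
  qed
  show ?thesis
  proof (rule Lim_null_comparison)
    show "\<forall>\<^sub>F t in at_top. norm (exp (- nu * t) * f t) \<le> C * (exp (- nu * t) * (1 + t) ^ p)"
      using eventually_ge_at_top[of "0::real"]
    proof eventually_elim
      case (elim t)
      then show ?case
          using mult_left_mono[OF C(2)[of t], of "exp (- nu * t)"] by (simp add: abs_mult mult_ac)
    qed
  qed (use lim in simp)
qed

section \<open>Averages over the exponential law\<close>

definition exp_law :: "real \<Rightarrow> real measure" where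
  "exp_law nu = density lborel (\<lambda>t. ennreal (exponential_density nu t))"

lemma sets_exp_law [simp, measurable_cong]: "sets (exp_law nu) = sets borel"
  by (simp add: exp_law_def)

lemma space_exp_law [simp]: "space (exp_law nu) = UNIV"
  by (simp add: exp_law_def)

lemma prob_space_exp_law: "0 < nu \<Longrightarrow> prob_space (exp_law nu)"
  unfolding exp_law_def by (rule prob_space_exponential_density)

lemma exp_law_power_moment:
  assumes "0 < nu"
  shows "integrable (exp_law nu) (\<lambda>t. t ^ i)" "(\<integral>t. t ^ i \<partial>exp_law nu) = fact i / nu ^ i"
proof -
  interpret prob_space "exp_law nu"
    using assms by (rule prob_space_exp_law)
  have "distributed (exp_law nu) lborel (\<lambda>t. t) (exponential_density nu)"
    by (auto simp: distributed_def exp_law_def distr_id2)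
  then show "integrable (exp_law nu) (\<lambda>t. t ^ i)" "(\<integral>t. t ^ i \<partial>exp_law nu) = fact i / nu ^ i"
    using erlang_ith_moment_integrable[OF assms] erlang_ith_moment[OF assms] by simp_all
qed

lemma AE_exp_law_nonneg: "AE t in exp_law nu. 0 \<le> t"
  unfolding exp_law_def by (subst AE_density) (auto simp: exponential_density_def)

text \<open>Splitting at \<open>X = 1\<close> gives the dominating function
  \<open>2 ^ p * (1 + X ^ q)\<close>.\<close>

lemma integrable_power_of_nonneg:
  fixes X :: "'a \<Rightarrow> real"
  assumes [measurable]: "X \<in> borel_measurable M" and fin: "finite_measure M"
    and "integrable M (\<lambda>x. X x ^ q)" "AE x in M. 0 \<le> X x" "p \<le> q"
  shows "integrable M (\<lambda>x. (1 + X x) ^ p)"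
proof -
  interpret finite_measure M by fact
  have *: "integrable M (\<lambda>x. 2 ^ p * (1 + X x ^ q))"
    using assms(3) by auto
  show ?thesis
  proof (rule Bochner_Integration.integrable_bound[OF *])
    show "AE x in M. norm ((1 + X x) ^ p) \<le> norm (2 ^ p * (1 + X x ^ q))"
      using assms(4)
    proof eventually_elim
      case (elim x)
      have "(1 + X x) ^ p \<le> 2 ^ p * (1 + X x ^ q)"
      proof (cases "X x \<le> 1")
        case True
        then have "(1 + X x) ^ p \<le> 2 ^ p * 1"
          using elim power_mono[of "1 + X x" 2 p] by auto
        also have "\<dots> \<le> 2 ^ p * (1 + X x ^ q)"
          using elim by (intro mult_left_mono) auto
        finally show ?thesis .
      next
        case False
        then have "(1 + X x) ^ p \<le> (2 * X x) ^ p"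
          by (intro power_mono) auto
        also have "\<dots> = 2 ^ p * X x ^ p"
          by (simp add: power_mult_distrib)
        also have "\<dots> \<le> 2 ^ p * (1 + X x ^ q)"
          using False power_increasing[OF assms(5), of "X x"] by (intro mult_left_mono) (linarith | simp)+
        finally show ?thesis .
      qed
      then show ?case
        using elim by simp
    qed
  qed measurable
qed

lemma poly_bounded_integrable:
  assumes "poly_bounded p f" and [measurable]: "f \<in> borel_measurable borel"
    and [measurable_cong]: "sets M = sets borel" and int: "integrable M (\<lambda>t. (1 + t) ^ p)"
    and "AE t in M. 0 \<le> t"
  shows "integrable M (\<lambda>t. f (x + t))"
proof -
  obtain C where C: "C \<ge> 0" "\<And>x t. \<bar>f (x + t)\<bar> \<le> C * (1 + \<bar>x\<bar>) ^ p * (1 + \<bar>t\<bar>) ^ p"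
    using poly_bounded_addD[OF assms(1)] by blast
  have *: "integrable M (\<lambda>t. C * (1 + \<bar>x\<bar>) ^ p * (1 + t) ^ p)"
    using int by auto
  show ?thesis
  proof (rule Bochner_Integration.integrable_bound[OF *])
    show "AE t in M. norm (f (x + t)) \<le> norm (C * (1 + \<bar>x\<bar>) ^ p * (1 + t) ^ p)"
      using assms(5)
    proof eventually_elim
      case (elim t)
      then show ?case
        using C(1) C(2)[of x t] by (simp add: abs_mult)
    qed
  qed measurable
qed

lemma exp_law_one_plus_power_integrable:
  assumes "0 < nu"
  shows "integrable (exp_law nu) (\<lambda>t. (1 + t) ^ p)"
  by (rule integrable_power_of_nonneg[OF _ _ exp_law_power_moment(1) AE_exp_law_nonneg order_refl])
    (use assms prob_space_exp_law[OF assms] in \<open>auto simp: prob_space_def\<close>)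

lemma exp_law_poly_integrable:
  assumes "0 < nu" "poly_bounded p f" "f \<in> borel_measurable borel"
  shows "integrable (exp_law nu) (\<lambda>t. f (x + t))"
  by (rule poly_bounded_integrable[OF assms(2,3) _ exp_law_one_plus_power_integrable[OF assms(1)]
        AE_exp_law_nonneg]) simp

lemma integrable_exp_law_iff:
  assumes [measurable]: "h \<in> borel_measurable borel" and "0 < nu"
  shows "integrable (exp_law nu) h \<longleftrightarrow> integrable lborel (\<lambda>t. exponential_density nu t * h t)"
  unfolding exp_law_def
  using assms by (subst integrable_density) (auto simp: exponential_density_def)

lemma integral_exp_law_eq:
  assumes [measurable]: "h \<in> borel_measurable borel" and "0 < nu"
  shows "(\<integral>t. h t \<partial>exp_law nu) = (\<integral>t. exponential_density nu t * h t \<partial>lborel)"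
  unfolding exp_law_def
  using assms by (subst integral_density) (auto simp: exponential_density_def)

text \<open>The finite exceptional set \<open>X\<close> makes room for the kink that functions of
  \<open>max 0 (d - t)\<close> have at \<open>t = d\<close>.\<close>

lemma exp_law_truncated_integral:
  assumes nu: "0 < nu" and int: "integrable (exp_law nu) h" and b: "0 \<le> b" and fin: "finite X"
    and cont: "continuous_on {0..} G"
    and G: "\<And>t. 0 < t \<Longrightarrow> t \<notin> X \<Longrightarrow> (G has_real_derivative - nu * exp (- nu * t) * h t) (at t)"
  shows "(\<integral>t. indicator {..b} t *\<^sub>R (exponential_density nu t * h t) \<partial>lborel) = G 0 - G b"
proof -
  have meas: "h \<in> borel_measurable borel"
    using borel_measurable_integrable[OF int] by (simp add: measurable_cong_sets[OF sets_exp_law refl])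
  let ?h = "\<lambda>t. exponential_density nu t * h t"
  have int': "integrable lborel ?h"
    using integrable_exp_law_iff[OF meas nu] int by simp
  have si: "set_integrable lborel {0..b} ?h"
    unfolding set_integrable_def by (intro integrable_mult_indicator int') auto
  have "((\<lambda>t. - ?h t) has_integral (G b - G 0)) {0..b}"
  proof (rule fundamental_theorem_of_calculus_interior_strong[where S = X])
    show "(G has_vector_derivative - ?h t) (at t)" if "t \<in> {0<..<b} - X" for t
      using G[of t] that by (simp add: has_real_derivative_iff_has_vector_derivative exponential_density_def mult.commute)
  qed (use fin b cont in \<open>auto intro: continuous_on_subset\<close>)
  then have "(?h has_integral (G 0 - G b)) {0..b}"
    by (metis (no_types, lifting) has_integral_neg has_integral_eq minus_minus minus_diff_eq)
  moreover have "(\<integral>t. indicator {..b} t *\<^sub>R ?h t \<partial>lborel) = (LINT t:{0..b}|lborel. ?h t)"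
    unfolding set_lebesgue_integral_def
    by (intro Bochner_Integration.integral_cong) (auto simp: indicator_def exponential_density_def)
  ultimately show ?thesis
    using set_borel_integral_eq_integral(2)[OF si] integral_unique by metis
qed

text \<open>Convergence of \<open>G\<close> at infinity is a conclusion here: it follows from
  integrability of \<open>h\<close>. This is what produces the limit of an antiderivative that is
  known only abstractly.\<close>

lemma exp_law_integral_limit:
  assumes nu: "0 < nu" and int: "integrable (exp_law nu) h" and fin: "finite X"
    and cont: "continuous_on {0..} G"
    and G: "\<And>t. 0 < t \<Longrightarrow> t \<notin> X \<Longrightarrow> (G has_real_derivative - nu * exp (- nu * t) * h t) (at t)"
  shows "(G \<longlongrightarrow> G 0 - (\<integral>t. h t \<partial>exp_law nu)) at_top"
proof -
  have meas: "h \<in> borel_measurable borel"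
    using borel_measurable_integrable[OF int] by (simp add: measurable_cong_sets[OF sets_exp_law refl])
  let ?h = "\<lambda>t. exponential_density nu t * h t"
  have int': "integrable lborel ?h"
    using integrable_exp_law_iff[OF meas nu] int by simp
  have "((\<lambda>b. \<integral>t. indicator {..b} t *\<^sub>R ?h t \<partial>lborel) \<longlongrightarrow> (\<integral>t. h t \<partial>exp_law nu)) at_top"
    unfolding integral_exp_law_eq[OF meas nu]
    by (rule tendsto_integral_at_top[OF _ int']) simp
  then have "((\<lambda>b. G 0 - G b) \<longlongrightarrow> (\<integral>t. h t \<partial>exp_law nu)) at_top"
    by (rule Lim_transform_eventually)
      (use eventually_ge_at_top[of "0::real"] in \<open>eventually_elim,
        use exp_law_truncated_integral[OF nu int _ fin cont G] in auto\<close>)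
  from tendsto_diff[OF tendsto_const[of "G 0"] this] show ?thesis
    by simp
qed

lemma exp_law_integral:
  assumes "0 < nu" "integrable (exp_law nu) h" "finite X" "continuous_on {0..} G"
    and "\<And>t. 0 < t \<Longrightarrow> t \<notin> X \<Longrightarrow> (G has_real_derivative - nu * exp (- nu * t) * h t) (at t)"
    and "(G \<longlongrightarrow> 0) at_top"
  shows "(\<integral>t. h t \<partial>exp_law nu) = G 0"
  using tendsto_unique[OF _ exp_law_integral_limit[OF assms(1-5)] assms(6)] by simp

section \<open>The averaging operator and its first-order equation\<close>

definition exp_average :: "real \<Rightarrow> (real \<Rightarrow> real) \<Rightarrow> real \<Rightarrow> real" where
  "exp_average nu f x = (\<integral>t. f (x + t) \<partial>exp_law nu)"

lemma poly_bounded_exp_average: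
  assumes nu: "0 < nu" and "poly_bounded p f" "f \<in> borel_measurable borel"
  shows "poly_bounded p (exp_average nu f)"
proof -
  obtain C where C: "C \<ge> 0" "\<And>x t. \<bar>f (x + t)\<bar> \<le> C * (1 + \<bar>x\<bar>) ^ p * (1 + \<bar>t\<bar>) ^ p"
    using poly_bounded_addD[OF assms(2)] by blast
  let ?I = "\<integral>t. (1 + t) ^ p \<partial>exp_law nu"
  have I: "0 \<le> ?I"
    using AE_exp_law_nonneg[of nu] by (intro integral_nonneg_AE) (auto elim!: eventually_mono)
  have "\<bar>exp_average nu f x\<bar> \<le> (C * ?I) * (1 + \<bar>x\<bar>) ^ p" for x
  proof -
    have "\<bar>exp_average nu f x\<bar> \<le> (\<integral>t. C * (1 + \<bar>x\<bar>) ^ p * (1 + t) ^ p \<partial>exp_law nu)"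
      unfolding exp_average_def
    proof (rule integral_abs_bound[THEN order_trans], rule integral_mono_AE)
      show "AE t in exp_law nu. \<bar>f (x + t)\<bar> \<le> C * (1 + \<bar>x\<bar>) ^ p * (1 + t) ^ p"
        using AE_exp_law_nonneg[of nu]
      proof eventually_elim
        case (elim t)
        then show ?case
          using C(2)[of x t] by simp
      qed
    qed (use exp_law_poly_integrable[OF assms] exp_law_one_plus_power_integrable[OF nu] in auto)
    then show ?thesis
      by (simp add: mult_ac)
  qed
  with C(1) I show ?thesis
    unfolding poly_bounded_def by (intro exI[of _ "C * ?I"]) auto
qed

text \<open>The tilted antiderivative \<open>F\<close> of \<open>nu e\<^bsup>-nu s\<^esup> f(s)\<close> has a limit \<open>L\<close> at infinity, and the average is
  \<open>e\<^bsup>nu x\<^esup> (L - F x)\<close>, which makes it differentiable.\<close>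

lemma exp_average_has_derivative:
  assumes nu: "0 < nu" and pb: "poly_bounded p f" and cont: "\<And>x. isCont f x"
  shows "(exp_average nu f has_real_derivative nu * (exp_average nu f x - f x)) (at x)"
proof -
  have meas: "f \<in> borel_measurable borel"
    using cont by (intro borel_measurable_continuous_onI continuous_at_imp_continuous_on) auto
  have "\<exists>F. \<forall>x::real. - \<infinity> < ereal x \<longrightarrow> ereal x < \<infinity> \<longrightarrow> (F has_vector_derivative nu * exp (- nu * x) * f x) (at x)"
    by (rule einterval_antiderivative) (auto intro!: continuous_intros cont)
  then obtain F where F: "\<And>x. (F has_real_derivative nu * exp (- nu * x) * f x) (at x)"
    by (auto simp: has_real_derivative_iff_has_vector_derivative)
  \<comment> \<open>For each base point \<open>x\<close>, multiplying \<open>F (x + t)\<close> by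
    \<open>- exp (nu * x)\<close> turns it into an antiderivative in \<open>t\<close> of
    \<open>- nu * exp (- nu * t) * f (x + t)\<close>, so the limit lemma applies.\<close>
  have lim: "((\<lambda>t. - (exp (nu * x) * F (x + t))) \<longlongrightarrow> - (exp (nu * x) * F x) - exp_average nu f x) at_top" for x
  proof -
    have *: "((\<lambda>t. - (exp (nu * x) * F (x + t))) has_real_derivative - nu * exp (- nu * t) * f (x + t)) (at t)" for t
    proof -
      have "((\<lambda>t. - (exp (nu * x) * F (x + t))) has_real_derivative
          - (exp (nu * x) * (nu * exp (- nu * (x + t)) * f (x + t)))) (at t)"
        by (auto intro!: derivative_eq_intros has_real_derivative_shift[OF F])
      moreover have "exp (nu * x) * exp (- nu * (x + t)) = exp (- nu * t)"
        by (simp add: exp_add[symmetric] algebra_simps)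
      then have "exp (nu * x) * (nu * exp (- nu * (x + t)) * f (x + t)) = nu * exp (- nu * t) * f (x + t)"
        by (metis mult.assoc mult.left_commute)
      ultimately show ?thesis
        by (simp only: mult_minus_left)
    qed
    have "continuous_on {0..} (\<lambda>t. - (exp (nu * x) * F (x + t)))"
      by (rule DERIV_continuous_on[OF has_field_derivative_at_within[OF *]])
    from exp_law_integral_limit[OF nu exp_law_poly_integrable[OF nu pb meas] finite.emptyI this *]
    show ?thesis
      by (simp add: exp_average_def)
  qed
  \<comment> \<open>The base point \<open>0\<close> fixes the value of the limit; uniqueness of
    limits then identifies the average at every other \<open>x\<close>.\<close>
  define L where "L = F 0 + exp_average nu f 0"
  have FL: "(F \<longlongrightarrow> L) at_top"
    using tendsto_minus[OF lim[of 0]] by (simp add: L_def add.commute)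
  have avg: "exp_average nu f = (\<lambda>x. exp (nu * x) * (L - F x))"
  proof
    fix x
    have "((\<lambda>t. F (x + t)) \<longlongrightarrow> L) at_top"
      by (rule filterlim_compose[OF FL]) (rule filterlim_tendsto_add_at_top[OF tendsto_const filterlim_ident])
    then have "((\<lambda>t. - (exp (nu * x) * F (x + t))) \<longlongrightarrow> - (exp (nu * x) * L)) at_top"
      by (intro tendsto_intros)
    from tendsto_unique[OF _ lim[of x] this] show "exp_average nu f x = exp (nu * x) * (L - F x)"
      by (simp add: algebra_simps)
  qed
  have "((\<lambda>x. exp (nu * x) * (L - F x)) has_real_derivative
      exp (nu * x) * nu * (L - F x) + (0 - nu * exp (- nu * x) * f x) * exp (nu * x)) (at x)"
    by (auto intro!: derivative_eq_intros F simp: mult_ac)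
  moreover have "exp (- nu * x) * exp (nu * x) = 1"
    by (simp add: exp_add[symmetric])
  then have "exp (nu * x) * nu * (L - F x) + (0 - nu * exp (- nu * x) * f x) * exp (nu * x)
      = nu * (exp (nu * x) * (L - F x) - f x)"
    by algebra
  ultimately show ?thesis
    unfolding avg by simp
qed

text \<open>Two solutions of the equation differ by a multiple of \<open>exp (nu * x)\<close>, which
  polynomial growth excludes. Concretely, \<open>exp (- nu * t) * y (x + t)\<close> is the
  antiderivative that computes the average, and growth makes it vanish at infinity.\<close>

lemma exp_average_eqI:
  assumes nu: "0 < nu" and "poly_bounded p y" "poly_bounded q f" and meas: "f \<in> borel_measurable borel"
    and y: "\<And>x. (y has_real_derivative nu * (y x - f x)) (at x)"
  shows "exp_average nu f x = y x"
proof -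
  have *: "((\<lambda>t. exp (- nu * t) * y (x + t)) has_real_derivative - nu * exp (- nu * t) * f (x + t)) (at t)" for t
  proof -
    have "((\<lambda>t. exp (- nu * t) * y (x + t)) has_real_derivative
        (exp (- nu * t) * (- nu * 1)) * y (x + t) + (nu * (y (x + t) - f (x + t)) * (0 + 1)) * exp (- nu * t)) (at t)"
      by (auto intro!: derivative_eq_intros has_real_derivative_shift[OF y])
    then show ?thesis
      by (simp add: algebra_simps)
  qed
  have "continuous_on {0..} (\<lambda>t. exp (- nu * t) * y (x + t))"
    by (rule DERIV_continuous_on[OF has_field_derivative_at_within[OF *]])
  from exp_law_integral[OF nu exp_law_poly_integrable[OF nu assms(3) meas] finite.emptyI this *
      poly_bounded_exp_decay[OF poly_bounded_shift[OF assms(2)] nu]]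
  show ?thesis
    by (simp add: exp_average_def)
qed

text \<open>The right-hand side solves the first-order equation with source \<open>f'\<close> and
  has polynomial growth, so uniqueness identifies it; this replaces both integration by parts and
  differentiation under the integral.\<close>

lemma exp_average_of_derivative:
  assumes nu: "0 < nu" and "poly_bounded p f" "poly_bounded q f'"
    and f: "\<And>x. (f has_real_derivative f' x) (at x)"
  shows "exp_average nu f' x = nu * (exp_average nu f x - f x)"
proof -
  have cont: "isCont f x" for x
    using f by (rule DERIV_isCont)
  have meas[measurable]: "f \<in> borel_measurable borel"
    using cont by (intro borel_measurable_continuous_onI continuous_at_imp_continuous_on) auto
  have meas': "f' \<in> borel_measurable borel"
    using borel_measurable_derivative_on[of f UNIV f'] f by simp
  have "exp_average nu f' x = (\<lambda>x. nu * (exp_average nu f x - f x)) x"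
  proof (rule exp_average_eqI[OF nu _ assms(3) meas'])
    show "poly_bounded p (\<lambda>x. nu * (exp_average nu f x - f x))"
      using poly_bounded_cmult[OF poly_bounded_add[OF poly_bounded_exp_average[OF nu assms(2) meas] poly_bounded_cmult[OF assms(2), of "-1"]], of nu]
      by simp
    show "((\<lambda>x. nu * (exp_average nu f x - f x)) has_real_derivative
       nu * (nu * (exp_average nu f x - f x) - f' x)) (at x)" for x
      by (auto intro!: derivative_eq_intros exp_average_has_derivative[OF nu assms(2) cont] f)
  qed
  then show ?thesis
    by simp
qed

lemma exp_average_abs_le:
  assumes "0 < nu" "\<And>x. \<bar>f x\<bar> \<le> B"
  shows "\<bar>exp_average nu f x\<bar> \<le> B"
proof -
  interpret prob_space "exp_law nu"
    using assms(1) by (rule prob_space_exp_law)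
  have "0 \<le> B"
    using assms(2)[of 0] by linarith
  \<comment> \<open>If the integral does not exist, the average is the default value
    \<open>0\<close>, which \<open>0 \<le> B\<close> covers.\<close>
  show ?thesis
  proof (cases "integrable (exp_law nu) (\<lambda>t. f (x + t))")
    case True
    have "\<bar>exp_average nu f x\<bar> \<le> (\<integral>t. B \<partial>exp_law nu)"
      unfolding exp_average_def
      by (rule integral_abs_bound[THEN order_trans], rule integral_mono) (use True assms(2) in auto)
    then show ?thesis
      using prob_space by simp
  qed (use \<open>0 \<le> B\<close> in \<open>simp add: exp_average_def not_integrable_integral_eq\<close>)
qed

section \<open>Towers of derivatives\<close>

text \<open>A tower lists the successive derivatives as \<open>u 0, u 1, ...\<close>. Its top member
  \<open>u n\<close> is a bounded derivative that may be discontinuous, as for Zolotarev test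
  functions, so the Lagrange form of the remainder is used.\<close>

lemma taylor_abs_le:
  assumes n: "0 < n"
    and deriv: "\<And>j x. j < n \<Longrightarrow> (u j has_real_derivative u (Suc j) x) (at x)"
    and bound: "\<And>x. \<bar>u n x\<bar> \<le> B" and s: "0 \<le> s"
  shows "\<bar>u 0 (w + s) - (\<Sum>i<n. u i w / fact i * s ^ i)\<bar> \<le> B / fact n * s ^ n"
\<comment> \<open>The Lagrange form asks for a positive increment; at \<open>s = 0\<close> only the
  term \<open>i = 0\<close> of the polynomial survives.\<close>
proof (cases "s = 0")
  case True
  have "(\<Sum>i<n. u i w / fact i * s ^ i) = (\<Sum>i<n. if i = 0 then u 0 w else 0)"
    using True by (intro sum.cong) (auto simp: power_0_left)
  then show ?thesis
    using True n by (simp add: power_0_left)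
next
  case False
  then have s: "0 < s"
    using s by simp
  obtain t where
    "u 0 (w + s) = (\<Sum>m<n. u m (w + 0) / fact m * s ^ m) + u n (w + t) / fact n * s ^ n"
    using Maclaurin[where diff = "\<lambda>m t. u m (w + t)" and f = "\<lambda>t. u 0 (w + t)", OF s n refl]
      has_real_derivative_shift[OF deriv] by blast
  then have "\<bar>u 0 (w + s) - (\<Sum>i<n. u i w / fact i * s ^ i)\<bar> = \<bar>u n (w + t)\<bar> / fact n * s ^ n"
    using s by (simp add: abs_mult)
  also have "\<dots> \<le> B / fact n * s ^ n"
    using s bound[of "w + t"] by (intro mult_right_mono divide_right_mono) auto
  finally show ?thesis .
qed

lemma integrable_power_le:
  fixes M :: "real measure"
  assumes "finite_measure M" and [measurable_cong]: "sets M = sets borel" and "AE s in M. 0 \<le> s"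
    and "integrable M (\<lambda>s. s ^ n)" "i \<le> n"
  shows "integrable M (\<lambda>s. s ^ i)"
proof (rule Bochner_Integration.integrable_bound)
  show "integrable M (\<lambda>s. (1 + s) ^ i)"
    by (rule integrable_power_of_nonneg[OF _ assms(1,4,3,5)]) measurable
  show "AE s in M. norm (s ^ i) \<le> norm ((1 + s) ^ i)"
    using assms(3) by eventually_elim (auto intro!: power_mono)
qed measurable

text \<open>Descending induction from the bounded top member, each integration raising the degree by
  one.\<close>

lemma poly_bounded_tower:
  assumes deriv: "\<And>j x. j < n \<Longrightarrow> (u j has_real_derivative u (Suc j) x) (at x)"
    and bound: "\<And>x. \<bar>u n x\<bar> \<le> B" and "j \<le> n"
  shows "poly_bounded (n - j) (u j)"
  using \<open>j \<le> n\<close>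
proof (induction rule: inc_induct)
  case base
  have "0 \<le> B"
    using bound[of 0] by linarith
  with bound show ?case
    unfolding poly_bounded_def by auto
next
  case (step m)
  then have "poly_bounded (Suc (n - Suc m)) (u m)"
    using deriv[of m] by (intro poly_bounded_antiderivative)
  then show ?case
    using step(2) by (simp add: Suc_diff_Suc)
qed

text \<open>Members below the top are continuous because they are differentiable; the top one is a
  limit of difference quotients.\<close>

lemma measurable_tower:
  fixes u :: "nat \<Rightarrow> real \<Rightarrow> real"
  assumes deriv: "\<And>j x. j < n \<Longrightarrow> (u j has_real_derivative u (Suc j) x) (at x)"
    and "0 < n" "j \<le> n"
  shows "u j \<in> borel_measurable borel"
proof -
  have *: "u i \<in> borel_measurable borel" if "i < n" for i
    using deriv[OF that] by (intro borel_measurable_continuous_onI continuous_at_imp_continuous_on)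
      (auto intro: DERIV_isCont)
  show ?thesis
  proof (cases "j < n")
    case False
    then obtain i where i: "j = Suc i" "i < n"
      using assms(2,3) by (cases j) auto
    show ?thesis
      using borel_measurable_derivative_on[of "u i" UNIV "u j"] *[OF i(2)] deriv[OF i(2)] i(1) by simp
  qed (rule *)
qed

lemma taylor_expectation_abs_le:
  assumes n: "0 < n"
    and deriv: "\<And>j x. j < n \<Longrightarrow> (u j has_real_derivative u (Suc j) x) (at x)"
    and bound: "\<And>x. \<bar>u n x\<bar> \<le> B"
    and P: "prob_space P" and sets[measurable_cong]: "sets P = sets borel" and nonneg: "AE s in P. 0 \<le> s"
    and int: "integrable P (\<lambda>s. s ^ n)"
  shows "\<bar>(\<integral>s. u 0 (w + s) \<partial>P) - (\<Sum>i<n. u i w / fact i * (\<integral>s. s ^ i \<partial>P))\<bar>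
    \<le> B / fact n * (\<integral>s. s ^ n \<partial>P)"
proof -
  interpret prob_space P by fact
  note [measurable] = measurable_tower[where u = u and j = 0, OF deriv n le0]
  have ints: "integrable P (\<lambda>s. s ^ i)" if "i < n" for i
    using integrable_power_le[OF _ sets nonneg int, of i] that by (simp add: finite_measure_axioms)
  have "integrable P (\<lambda>s. (1 + s) ^ n)"
    by (rule integrable_power_of_nonneg[OF _ _ int nonneg order_refl]) (auto simp: finite_measure_axioms)
  then have int0: "integrable P (\<lambda>s. u 0 (w + s))"
    using poly_bounded_integrable[OF poly_bounded_tower[OF deriv bound, of 0, simplified] _ sets _ nonneg]
    by simp
  have int_poly: "integrable P (\<lambda>s. \<Sum>i<n. u i w / fact i * s ^ i)"
    by (intro Bochner_Integration.integrable_sum integrable_mult_right ints) auto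
  have "(\<integral>s. u 0 (w + s) \<partial>P) - (\<Sum>i<n. u i w / fact i * (\<integral>s. s ^ i \<partial>P))
      = (\<integral>s. u 0 (w + s) - (\<Sum>i<n. u i w / fact i * s ^ i) \<partial>P)"
    by (subst Bochner_Integration.integral_diff[OF int0 int_poly], subst Bochner_Integration.integral_sum)
      (auto simp: ints)
  also have "\<bar>\<dots>\<bar> \<le> (\<integral>s. B / fact n * s ^ n \<partial>P)"
  proof (rule integral_abs_bound[THEN order_trans], rule integral_mono_AE)
    show "AE s in P. \<bar>u 0 (w + s) - (\<Sum>i<n. u i w / fact i * s ^ i)\<bar> \<le> B / fact n * s ^ n"
      using nonneg by eventually_elim (rule taylor_abs_le[OF n deriv bound])
  qed (intro integrable_abs Bochner_Integration.integrable_diff int0 int_poly integrable_mult_right int)+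
  finally show ?thesis
    by simp
qed

text \<open>The mean of the Taylor polynomial at \<open>w\<close> depends only on moments below
  \<open>n\<close>, so it is the same under \<open>P\<close> and \<open>Q\<close>, and just the two
  remainders are left.\<close>

lemma matched_moments_abs_le:
  assumes n: "0 < n"
    and deriv: "\<And>j x. j < n \<Longrightarrow> (u j has_real_derivative u (Suc j) x) (at x)"
    and bound: "\<And>x. \<bar>u n x\<bar> \<le> B"
    and P: "prob_space P" "sets P = sets borel" "AE s in P. 0 \<le> s" "integrable P (\<lambda>s. s ^ n)"
    and Q: "prob_space Q" "sets Q = sets borel" "AE s in Q. 0 \<le> s" "integrable Q (\<lambda>s. s ^ n)"
    and eq: "\<And>i. i < n \<Longrightarrow> (\<integral>s. s ^ i \<partial>P) = (\<integral>s. s ^ i \<partial>Q)"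
  shows "\<bar>(\<integral>s. u 0 (w + s) \<partial>P) - (\<integral>s. u 0 (w + s) \<partial>Q)\<bar>
    \<le> B / fact n * ((\<integral>s. s ^ n \<partial>P) + (\<integral>s. s ^ n \<partial>Q))"
  using taylor_expectation_abs_le[OF n deriv bound P, of w] taylor_expectation_abs_le[OF n deriv bound Q, of w]
  by (simp add: eq distrib_left)

lemma exp_average_tower_deriv:
  assumes nu: "0 < nu"
    and deriv: "\<And>j x. j < n \<Longrightarrow> (f j has_real_derivative f (Suc j) x) (at x)"
    and bound: "\<And>x. \<bar>f n x\<bar> \<le> B" and "j < n"
  shows "exp_average nu (f (Suc j)) x = nu * (exp_average nu (f j) x - f j x)"
    and "(exp_average nu (f j) has_real_derivative exp_average nu (f (Suc j)) x) (at x)"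
proof -
  show *: "exp_average nu (f (Suc j)) x = nu * (exp_average nu (f j) x - f j x)"
    using \<open>j < n\<close>
    by (intro exp_average_of_derivative[OF nu poly_bounded_tower[OF deriv bound, of j] poly_bounded_tower[OF deriv bound, of "Suc j"]] deriv)
      auto
  show "(exp_average nu (f j) has_real_derivative exp_average nu (f (Suc j)) x) (at x)"
    unfolding * using \<open>j < n\<close>
    by (intro exp_average_has_derivative[OF nu poly_bounded_tower[OF deriv bound, of j]] DERIV_isCont[OF deriv])
      auto
qed

text \<open>The top member \<open>f n\<close> may be discontinuous, which bars the first-order
  equation for its average. Rewriting that average through the member below, which is
  differentiable, gains the extra derivative.\<close>

lemma exp_average_tower_deriv_top:
  assumes nu: "0 < nu"
    and deriv: "\<And>j x. j < n \<Longrightarrow> (f j has_real_derivative f (Suc j) x) (at x)"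
    and bound: "\<And>x. \<bar>f n x\<bar> \<le> B" and "0 < n"
  shows "(exp_average nu (f n) has_real_derivative nu * (exp_average nu (f n) x - f n x)) (at x)"
proof -
  obtain m where m: "n = Suc m"
    using \<open>0 < n\<close> by (cases n) auto
  have "exp_average nu (f n) = (\<lambda>x. nu * (exp_average nu (f m) x - f m x))"
    using exp_average_tower_deriv(1)[OF nu deriv bound, of m] m by auto
  then show ?thesis
    using exp_average_tower_deriv(2)[OF nu deriv bound, of m x] deriv[of m x] m
    by (auto intro!: derivative_eq_intros)
qed

section \<open>Integration by parts against a density\<close>

text \<open>Integrability yields no pointwise decay, but it does yield points arbitrarily far out
  where \<open>\<bar>G\<bar>\<close> is small: otherwise a constant on an interval of length
  \<open>(I + 1) / \<delta>\<close> would already exceed the integral. Such points serve as upper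
  cuts in an integration by parts.\<close>

lemma integrable_small_at_top:
  fixes G :: "real \<Rightarrow> real"
  assumes int: "integrable lborel (\<lambda>s. indicator {0<..} s * G s)" and \<delta>: "0 < (\<delta>::real)"
  shows "\<exists>b>c. \<bar>G b\<bar> < \<delta>"
proof (rule ccontr)
  assume "\<not> ?thesis"
  then have ge: "\<And>b. c < b \<Longrightarrow> \<delta> \<le> \<bar>G b\<bar>"
    by force
  define I where "I = enn2real (\<integral>\<^sup>+s. ennreal (norm (indicator {0<..} s * G s)) \<partial>lborel)"
  have I: "(\<integral>\<^sup>+s. ennreal (norm (indicator {0<..} s * G s)) \<partial>lborel) = ennreal I" "0 \<le> I"
    using int by (auto simp: I_def integrable_iff_bounded)
  let ?J = "{\<bar>c\<bar> + 1..\<bar>c\<bar> + 1 + (I + 1) / \<delta>}"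
  have "ennreal (I + 1) = ennreal \<delta> * ennreal ((I + 1) / \<delta>)"
    using \<delta> I(2) by (subst ennreal_mult[symmetric]) auto
  also have "\<dots> = (\<integral>\<^sup>+s. ennreal \<delta> * indicator ?J s \<partial>lborel)"
    using \<delta> I(2) by (subst nn_integral_cmult_indicator) auto
  also have "\<dots> \<le> (\<integral>\<^sup>+s. ennreal (norm (indicator {0<..} s * G s)) \<partial>lborel)"
    using ge by (intro nn_integral_mono) (auto simp: indicator_def)
  finally show False
    using I by simp
qed

text \<open>If \<open>a * \<bar>g a\<bar>\<close> stayed above \<open>\<delta>\<close> near
  \<open>0\<close>, then \<open>\<bar>g\<bar>\<close> would dominate \<open>\<delta> / s\<close>,
  whose integral diverges logarithmically.\<close>

lemma integrable_small_at_0: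
  fixes g :: "real \<Rightarrow> real"
  assumes int: "integrable lborel g" and \<delta>: "0 < \<delta>" and c: "0 < c"
  shows "\<exists>a. 0 < a \<and> a < c \<and> a * \<bar>g a\<bar> < \<delta>"
proof (rule ccontr)
  assume "\<not> ?thesis"
  then have ge: "\<delta> \<le> a * \<bar>g a\<bar>" if "0 < a" "a < c" for a
    using that by force
  define I where "I = enn2real (\<integral>\<^sup>+s. ennreal (norm (g s)) \<partial>lborel)"
  have I: "(\<integral>\<^sup>+s. ennreal (norm (g s)) \<partial>lborel) = ennreal I" "0 \<le> I"
    using int by (auto simp: I_def integrable_iff_bounded)
  define b where "b = c / 2"
  \<comment> \<open>Chosen so that \<open>\<delta> / s\<close> integrates over \<open>{a..b}\<close>
    to exactly \<open>I + 1\<close>.\<close>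
  define a where "a = b * exp (- (I + 1) / \<delta>)"
  have ab: "0 < a" "a \<le> b" "b < c" "0 < b"
    using c \<delta> I(2) by (auto simp: a_def b_def divide_nonpos_pos)
  have "(\<integral>\<^sup>+s. ennreal (\<delta> / s) * indicator {a..b} s \<partial>lborel) = ennreal (\<delta> * ln b - \<delta> * ln a)"
  proof (rule nn_integral_FTC_Icc)
    show "((\<lambda>s. \<delta> * ln s) has_real_derivative \<delta> / s) (at s)" if "s \<in> {a..b}" for s
      using that ab by (auto intro!: derivative_eq_intros)
  qed (use ab \<delta> in auto)
  moreover have "(\<integral>\<^sup>+s. ennreal (\<delta> / s) * indicator {a..b} s \<partial>lborel) \<le> ennreal I"
    unfolding I(1)[symmetric]
  proof (rule nn_integral_mono)
    show "ennreal (\<delta> / s) * indicator {a..b} s \<le> ennreal (norm (g s))" for s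
      using ge[of s] ab by (auto simp: indicator_def field_simps intro!: ennreal_leI)
  qed
  ultimately have "\<delta> * ln b - \<delta> * ln a \<le> I"
    using I(2) by (simp add: ennreal_le_iff)
  moreover have "\<delta> * ln b - \<delta> * ln a = I + 1"
    using ab \<delta> by (simp add: a_def ln_mult field_simps)
  ultimately show False
    by simp
qed

text \<open>The fundamental theorem is applied on intervals whose endpoints are cuts with small
  \<open>G\<close>; dominated convergence lets these intervals exhaust the half-line.\<close>

lemma integral_derivative_eq_0:
  fixes G r :: "real \<Rightarrow> real"
  assumes deriv: "\<And>s. 0 < s \<Longrightarrow> (G has_real_derivative r s) (at s)"
    and int: "integrable lborel (\<lambda>s. indicator {0<..} s * r s)"
    and top: "\<And>\<delta> c. 0 < \<delta> \<Longrightarrow> \<exists>b>c. \<bar>G b\<bar> < \<delta>"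
    and bot: "\<And>\<delta> c. 0 < \<delta> \<Longrightarrow> 0 < c \<Longrightarrow> \<exists>a. 0 < a \<and> a < c \<and> \<bar>G a\<bar> < \<delta>"
  shows "(\<integral>s. indicator {0<..} s * r s \<partial>lborel) = 0"
proof -
  have "\<forall>n. \<exists>b>real n + 1. \<bar>G b\<bar> < inverse (real (Suc n))"
    using top by auto
  then obtain b where b: "\<And>n. real n + 1 < b n" "\<And>n. \<bar>G (b n)\<bar> < inverse (real (Suc n))"
    by metis
  have "\<forall>n. \<exists>a. 0 < a \<and> a < inverse (real (Suc n)) \<and> \<bar>G a\<bar> < inverse (real (Suc n))"
    using bot by auto
  then obtain a where a: "\<And>n. 0 < a n" "\<And>n. a n < inverse (real (Suc n))" "\<And>n. \<bar>G (a n)\<bar> < inverse (real (Suc n))"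
    by metis
  let ?r = "\<lambda>s. indicator {0<..} s * r s"
  have eq: "(\<integral>s. indicator {a n..b n} s *\<^sub>R ?r s \<partial>lborel) = G (b n) - G (a n)" for n
  proof -
    have "a n \<le> 1"
      using a(2)[of n] by (intro order_trans[OF less_imp_le[OF a(2)]]) (simp add: inverse_le_1_iff)
    then have "a n \<le> b n"
      using b(1)[of n] by simp
    then have "(r has_integral (G (b n) - G (a n))) {a n..b n}"
      using a(1)[of n] by (intro fundamental_theorem_of_calculus)
        (auto simp: has_real_derivative_iff_has_vector_derivative[symmetric] intro!: has_field_derivative_at_within[OF deriv])
    then have "(?r has_integral (G (b n) - G (a n))) {a n..b n}"
      using a(1)[of n] by (subst has_integral_cong[where g = r]) auto
    moreover have "set_integrable lborel {a n..b n} ?r"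
      unfolding set_integrable_def by (intro integrable_mult_indicator int) auto
    ultimately show ?thesis
      using set_borel_integral_eq_integral(2) integral_unique unfolding set_lebesgue_integral_def by metis
  qed
  have "(\<lambda>n. \<integral>s. indicator {a n..b n} s *\<^sub>R ?r s \<partial>lborel) \<longlonglongrightarrow> (\<integral>s. ?r s \<partial>lborel)"
  proof (rule integral_dominated_convergence)
    show "integrable lborel (\<lambda>s. norm (?r s))"
      using int by (rule integrable_norm)
    show "AE s in lborel. (\<lambda>n. indicator {a n..b n} s *\<^sub>R ?r s) \<longlonglongrightarrow> ?r s"
    proof (rule AE_I2)
      fix s :: real
      show "(\<lambda>n. indicator {a n..b n} s *\<^sub>R ?r s) \<longlonglongrightarrow> ?r s"
      proof (cases "0 < s")
        case True
        have "\<forall>\<^sub>F n in sequentially. s \<le> real n"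
          using filterlim_real_sequentially by (auto simp: filterlim_at_top)
        moreover have "\<forall>\<^sub>F n in sequentially. inverse (real (Suc n)) < s"
          using LIMSEQ_inverse_real_of_nat True by (rule order_tendstoD)
        ultimately have "\<forall>\<^sub>F n in sequentially. indicator {a n..b n} s *\<^sub>R ?r s = ?r s"
        proof eventually_elim
          case (elim n)
          then show ?case
            using a(2)[of n] b(1)[of n] by simp
        qed
        then show ?thesis
          by (rule tendsto_eventually)
      qed simp
    qed
    show "AE s in lborel. norm (indicator {a n..b n} s *\<^sub>R ?r s) \<le> norm (?r s)" for n
      by (auto simp: indicator_def)
  qed (use int borel_measurable_integrable in \<open>auto intro!: borel_measurable_scaleR\<close>)
  moreover have "(\<lambda>n. G (b n) - G (a n)) \<longlonglongrightarrow> 0 - 0"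
  proof (rule tendsto_diff; rule Lim_null_comparison[OF _ LIMSEQ_inverse_real_of_nat])
    show "\<forall>\<^sub>F n in sequentially. norm (G (b n)) \<le> inverse (real (Suc n))"
      using less_imp_le[OF b(2)] by simp
    show "\<forall>\<^sub>F n in sequentially. norm (G (a n)) \<le> inverse (real (Suc n))"
      using less_imp_le[OF a(3)] by simp
  qed
  ultimately show ?thesis
    unfolding eq using LIMSEQ_unique by fastforce
qed

text \<open>The derivative of \<open>g * u\<close> is
  \<open>(g' + mu * g) * u - g * (mu * u - u')\<close> and integrates to \<open>0\<close> over the
  half-line, so the second term can be traded for the first, which \<open>C1\<close> controls. The
  density may be unbounded near \<open>0\<close>; there \<open>k \<ge> 1\<close> bounds
  \<open>g a * u a\<close> by a multiple of \<open>a * \<bar>g a\<bar>\<close>, which is small along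
  suitable \<open>a\<close>.\<close>

lemma density_by_parts:
  fixes g g' u u' :: "real \<Rightarrow> real"
  assumes g: "integrable lborel g" "\<And>y. y < 0 \<Longrightarrow> g y = 0"
      "\<And>y. 0 < y \<Longrightarrow> (g has_real_derivative g' y) (at y)"
    and u: "\<And>s. (u has_real_derivative u' s) (at s)" "\<And>s. 0 \<le> s \<Longrightarrow> \<bar>u s\<bar> \<le> C * s ^ k"
    and k: "1 \<le> k"
    and C1: "0 \<le> C1" "(\<integral>\<^sup>+y\<in>{0<..}. ennreal \<bar>y ^ k * (g' y + mu * g y)\<bar> \<partial>lborel) \<le> ennreal C1"
    and gu: "integrable lborel (\<lambda>s. g s * u s)" and gu': "integrable lborel (\<lambda>s. g s * u' s)"
  shows "\<bar>\<integral>s. g s * (mu * u s - u' s) \<partial>lborel\<bar> \<le> C * C1"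
proof -
  let ?I = "indicator {0<..} :: real \<Rightarrow> real"
  let ?v = "\<lambda>s. ?I s * (s ^ k * (g' s + mu * g s))"
  let ?vu = "\<lambda>s. ?I s * ((g' s + mu * g s) * u s)"
  have C: "0 \<le> C"
    using u(2)[of 1] by simp
  have [measurable]: "g \<in> borel_measurable borel" "u \<in> borel_measurable borel"
    using borel_measurable_integrable[OF g(1)] u(1)
    by (auto intro!: borel_measurable_continuous_onI continuous_at_imp_continuous_on DERIV_isCont)
  have "(\<lambda>s. ?I s * g' s) \<in> borel_measurable borel"
    by (rule borel_measurable_derivative_on[of g]) (use g(3) in auto)
  note [measurable] = this
  \<comment> \<open>Measurability is available for the product of \<open>g'\<close> with the
    indicator, so the indicator is moved onto \<open>g'\<close>.\<close>
  have v_eq: "?v = (\<lambda>s. s ^ k * (?I s * g' s + ?I s * (mu * g s)))"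
    by (auto simp: algebra_simps)
  have "?v \<in> borel_measurable borel"
    unfolding v_eq by measurable
  moreover have nn: "(\<integral>\<^sup>+s. ennreal (norm (?v s)) \<partial>lborel) \<le> ennreal C1"
    using C1(2) by (rule order_trans[rotated]) (auto intro!: nn_integral_mono simp: indicator_def)
  ultimately have int_v: "integrable lborel ?v"
    by (auto simp: integrable_iff_bounded less_top[symmetric] top_unique)
  have "ennreal (\<integral>s. norm (?v s) \<partial>lborel) \<le> ennreal C1"
    using nn int_v by (subst nn_integral_eq_integral[symmetric]) auto
  then have v_le: "(\<integral>s. norm (?v s) \<partial>lborel) \<le> C1"
    using C1(1) by (simp add: ennreal_le_iff)
  have bound: "norm (?vu s) \<le> C * norm (?v s)" for s
    using mult_left_mono[OF u(2)[of s], of "\<bar>g' s + mu * g s\<bar>"] by (auto simp: indicator_def abs_mult mult_ac)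
  have vu_eq: "?vu = (\<lambda>s. (?I s * g' s + ?I s * (mu * g s)) * u s)"
    by (auto simp: algebra_simps)
  have int_vu: "integrable lborel ?vu"
  proof (rule Bochner_Integration.integrable_bound)
    show "integrable lborel (\<lambda>s. C * norm (?v s))"
      using int_v by (intro integrable_mult_right integrable_norm)
    show "?vu \<in> borel_measurable lborel"
      unfolding vu_eq by measurable
  qed (use bound C in auto)
  have AE_nz: "AE s in lborel. s \<noteq> (0::real)"
    by (rule AE_lborel_singleton)
  have ind: "AE s in lborel. ?I s * g s = g s"
    using AE_nz by eventually_elim (use g(2) in \<open>auto simp: indicator_def not_less_iff_gr_or_eq\<close>)
  let ?r = "\<lambda>s. (g' s + mu * g s) * u s - g s * (mu * u s - u' s)"
  let ?w = "\<lambda>s. g s * (mu * u s - u' s)"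
  have int_w: "integrable lborel ?w"
    using Bochner_Integration.integrable_diff[OF integrable_mult_right[OF gu, of mu] gu'] by (simp add: algebra_simps)
  have int_Iw: "integrable lborel (\<lambda>s. ?I s *\<^sub>R ?w s)"
    by (intro integrable_mult_indicator int_w) auto
  have Ir: "?I s * ?r s = ?vu s - ?I s *\<^sub>R ?w s" for s
    by (simp add: algebra_simps)
  have "(\<integral>s. ?I s * ?r s \<partial>lborel) = 0"
  proof (rule integral_derivative_eq_0[where G = "\<lambda>s. g s * u s"])
    show "((\<lambda>s. g s * u s) has_real_derivative ?r s) (at s)" if "0 < s" for s
      using that by (auto intro!: derivative_eq_intros g(3) u(1) simp: algebra_simps)
    show "integrable lborel (\<lambda>s. ?I s * ?r s)"
      unfolding Ir using int_vu int_Iw by simp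
    show "\<exists>b>c. \<bar>g b * u b\<bar> < \<delta>" if "0 < \<delta>" for \<delta> c
    proof (rule integrable_small_at_top[OF _ that])
      show "integrable lborel (\<lambda>s. ?I s * (g s * u s))"
        using integrable_mult_indicator[OF _ gu, of "{0<..}"] by simp
    qed
    show "\<exists>a. 0 < a \<and> a < c \<and> \<bar>g a * u a\<bar> < \<delta>" if "0 < \<delta>" "0 < c" for \<delta> c
    proof -
      have pos: "0 < \<delta> / (C + 1)" "0 < min c 1"
        using that C by auto
      obtain a where a: "0 < a" "a < min c 1" "a * \<bar>g a\<bar> < \<delta> / (C + 1)"
        using integrable_small_at_0[OF g(1) pos] by blast
      have "\<bar>u a\<bar> \<le> C * a ^ k"
        using u(2) a(1) by simp
      also have "\<dots> \<le> (C + 1) * a ^ 1"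
        using C a k by (intro mult_mono power_decreasing) auto
      finally have "\<bar>g a * u a\<bar> \<le> (C + 1) * (a * \<bar>g a\<bar>)"
        using mult_left_mono[of "\<bar>u a\<bar>" "(C + 1) * a" "\<bar>g a\<bar>"] by (simp add: abs_mult mult_ac)
      also have "\<dots> < \<delta>"
        using a(3) C by (simp add: field_simps)
      finally show ?thesis
        using a by auto
    qed
  qed
  then have "(\<integral>s. ?vu s \<partial>lborel) = (\<integral>s. ?I s *\<^sub>R ?w s \<partial>lborel)"
    unfolding Ir using int_vu int_Iw by simp
  also have "\<dots> = (\<integral>s. ?w s \<partial>lborel)"
  proof (rule integral_cong_AE)
    show "AE s in lborel. ?I s *\<^sub>R ?w s = ?w s"
      using ind by eventually_elim (auto simp: indicator_def)
  qed (use int_Iw int_w borel_measurable_integrable in blast)+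
  finally have "\<bar>\<integral>s. ?w s \<partial>lborel\<bar> = \<bar>\<integral>s. ?vu s \<partial>lborel\<bar>"
    by simp
  also have "\<dots> \<le> (\<integral>s. C * norm (?v s) \<partial>lborel)"
  proof (rule integral_abs_bound[THEN order_trans], rule integral_mono)
    show "\<bar>?vu s\<bar> \<le> C * norm (?v s)" for s
      using bound[of s] by (simp only: real_norm_def)
  qed (intro integrable_abs integrable_mult_right integrable_norm int_vu int_v)+
  also have "\<dots> \<le> C * C1"
    using v_le C by (simp add: mult_left_mono)
  finally show ?thesis .
qed

text \<open>Let \<open>n\<close> be the exponential average of \<open>f\<close>. The equation
  \<open>f = n - n' / mu\<close> turns the expectation into an integral of
  \<open>g * (mu * u - u')\<close>, where \<open>mu * u\<close> is \<open>n\<close> minus its Taylor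
  polynomial at \<open>w\<close>. The moments below \<open>k\<close> make that polynomial contribute
  exactly \<open>n 0 w\<close>, the average under comparison.\<close>

lemma density_stein_bound:
  fixes g g' :: "real \<Rightarrow> real" and f :: "nat \<Rightarrow> real \<Rightarrow> real"
  defines "P \<equiv> density lborel (\<lambda>y. ennreal (g y))"
  assumes mu: "0 < mu" and k: "1 \<le> k"
    and deriv: "\<And>j x. j < k \<Longrightarrow> (f j has_real_derivative f (Suc j) x) (at x)"
    and bound: "\<And>x. \<bar>f k x\<bar> \<le> B"
    and P: "prob_space P" "integrable P (\<lambda>s. s ^ k)"
    and moments: "\<And>i. i < k \<Longrightarrow> (\<integral>s. s ^ i \<partial>P) = fact i / mu ^ i"
    and g: "g \<in> borel_measurable borel" "\<And>y. 0 \<le> g y" "\<And>y. y < 0 \<Longrightarrow> g y = 0"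
      "\<And>y. 0 < y \<Longrightarrow> (g has_real_derivative g' y) (at y)"
    and C1: "0 \<le> C1" "(\<integral>\<^sup>+y\<in>{0<..}. ennreal \<bar>y ^ k * (g' y + mu * g y)\<bar> \<partial>lborel) \<le> ennreal C1"
  shows "\<bar>(\<integral>s. f 0 (w + s) \<partial>P) - exp_average mu (f 0) w\<bar> \<le> B / fact k / mu * C1"
proof -
  interpret prob_space P by fact
  note [measurable] = g(1)
  have k0: "0 < k"
    using k by simp
  have sets_P [measurable_cong]: "sets P = sets borel"
    by (simp add: P_def)
  have nonneg: "AE s in P. 0 \<le> s"
    unfolding P_def using g(2,3)
    by (subst AE_density) (auto simp: not_less[symmetric] ennreal_zero_less_top)
  have iff: "integrable P h \<longleftrightarrow> integrable lborel (\<lambda>s. g s * h s)"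
    and eq: "(\<integral>s. h s \<partial>P) = (\<integral>s. g s * h s \<partial>lborel)" if "h \<in> borel_measurable borel" for h :: "real \<Rightarrow> real"
    using that g(2) by (auto simp: P_def integrable_density integral_density)
  define n where "n j = exp_average mu (f j)" for j
  have n_deriv: "(n j has_real_derivative n (Suc j) x) (at x)" if "j < k" for j x
    unfolding n_def using that by (intro exp_average_tower_deriv(2)[OF mu deriv bound])
  have n_bound: "\<bar>n k x\<bar> \<le> B" for x
    unfolding n_def by (intro exp_average_abs_le mu bound)
  have f0: "f 0 x = n 0 x - n 1 x / mu" for x
    using exp_average_tower_deriv(1)[OF mu deriv bound k0, of x] mu by (simp add: n_def field_simps)
  have n_meas [measurable]: "n j \<in> borel_measurable borel" if "j \<le> k" for j
    by (rule measurable_tower[where u = n, OF n_deriv k0 that])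
  have ints: "integrable P (\<lambda>s. s ^ i)" if "i \<le> k" for i
    using integrable_power_le[OF _ sets_P nonneg P(2) that] by (simp add: finite_measure_axioms)
  have int1: "integrable P (\<lambda>s. (1 + s) ^ p)" if "p \<le> k" for p
    by (rule integrable_power_of_nonneg[OF _ _ P(2) nonneg that]) (auto simp: finite_measure_axioms)
  have int_n: "integrable P (\<lambda>s. n j (w + s))" if "j \<le> k" for j
    using poly_bounded_integrable[OF poly_bounded_tower[where u = n, OF n_deriv n_bound that] n_meas[OF that] sets_P int1 nonneg]
    by simp
  \<comment> \<open>Removing the Taylor polynomial gives \<open>u\<close> a zero of order
    \<open>k\<close> at \<open>0\<close>. The bound \<open>B\<close> passes from \<open>f k\<close>
    to its average \<open>n k\<close>, whence the constant \<open>B / fact k / mu\<close>.\<close>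
  define u where "u s = (n 0 (w + s) - (\<Sum>i<k. n i w / fact i * s ^ i)) / mu" for s
  define u' where "u' s = (n 1 (w + s) - (\<Sum>i<k. n i w / fact i * (real i * s ^ (i - 1)))) / mu" for s
  have u_deriv: "(u has_real_derivative u' s) (at s)" for s
    unfolding u_def u'_def
    by (intro DERIV_cdivide DERIV_diff has_real_derivative_shift DERIV_sum DERIV_cmult)
      (use n_deriv[OF k0] in \<open>auto intro!: derivative_eq_intros\<close>)
  have u_bound: "\<bar>u s\<bar> \<le> (B / fact k / mu) * s ^ k" if "0 \<le> s" for s
    using divide_right_mono[OF taylor_abs_le[where u = n, OF k0 n_deriv n_bound that, of w], of mu] mu
    by (simp add: u_def abs_divide)
  have int_p: "integrable P (\<lambda>s. \<Sum>i<k. n i w / fact i * s ^ i)"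
    by (intro Bochner_Integration.integrable_sum integrable_mult_right ints) auto
  have int_p': "integrable P (\<lambda>s. \<Sum>i<k. n i w / fact i * (real i * s ^ (i - 1)))"
    by (intro Bochner_Integration.integrable_sum integrable_mult_right ints) auto
  have int_u: "integrable P u"
    unfolding u_def by (intro integrable_divide_zero Bochner_Integration.integrable_diff int_n int_p) auto
  have int_u': "integrable P u'"
    unfolding u'_def using k by (intro integrable_divide_zero Bochner_Integration.integrable_diff int_n int_p') auto
  have [measurable]: "u \<in> borel_measurable borel" "u' \<in> borel_measurable borel"
    using borel_measurable_integrable[OF int_u] borel_measurable_integrable[OF int_u']
    by (simp_all add: measurable_cong_sets[OF sets_P refl])
  have "(\<integral>s. g s * (mu * u s - u' s) \<partial>lborel) = mu * (\<integral>s. u s \<partial>P) - (\<integral>s. u' s \<partial>P)"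
    using int_u int_u' by (subst eq[symmetric]) auto
  also have "(\<integral>s. u s \<partial>P) = ((\<integral>s. n 0 (w + s) \<partial>P) - (\<Sum>i<k. n i w / fact i * (\<integral>s. s ^ i \<partial>P))) / mu"
    unfolding u_def integral_divide_zero
    by (subst Bochner_Integration.integral_diff[OF int_n[OF le0] int_p], subst Bochner_Integration.integral_sum)
      (auto simp: ints)
  also have "(\<integral>s. u' s \<partial>P)
      = ((\<integral>s. n 1 (w + s) \<partial>P) - (\<Sum>i<k. n i w / fact i * (real i * (\<integral>s. s ^ (i - 1) \<partial>P)))) / mu"
    unfolding u'_def integral_divide_zero
    by (subst Bochner_Integration.integral_diff[OF int_n[OF k] int_p'], subst Bochner_Integration.integral_sum)
      (auto simp: ints)
  also have "(\<Sum>i<k. n i w / fact i * (\<integral>s. s ^ i \<partial>P)) = (\<Sum>i<k. n i w / mu ^ i)"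
    by (intro sum.cong) (auto simp: moments)
  \<comment> \<open>Differentiating the polynomial kills the term \<open>i = 0\<close> and
    multiplies the mean of every other term by \<open>mu\<close>; the unmatched term
    \<open>i = 0\<close> is what survives as \<open>n 0 w\<close>.\<close>
  also have "(\<Sum>i<k. n i w / fact i * (real i * (\<integral>s. s ^ (i - 1) \<partial>P))) = (\<Sum>i<k. if i = 0 then 0 else mu * (n i w / mu ^ i))"
  proof (intro sum.cong refl)
    fix i assume "i \<in> {..<k}"
    then show "n i w / fact i * (real i * (\<integral>s. s ^ (i - 1) \<partial>P)) = (if i = 0 then 0 else mu * (n i w / mu ^ i))"
    proof (cases i)
      case (Suc m)
      have cancel: "c / (a * F) * (a * (F / M)) = mu * (c / (mu * M))" if "a \<noteq> 0" "F \<noteq> 0" for a c F M :: real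
        using that mu by simp
      have "m < k"
        using Suc \<open>i \<in> {..<k}\<close> by simp
      then have "(\<integral>s. s ^ (i - 1) \<partial>P) = fact m / mu ^ m"
        using Suc moments by simp
      then show ?thesis
        using cancel[of "real (Suc m)" "fact m"] Suc by (simp only: fact_Suc power_Suc) simp
    qed simp
  qed
  also have "(\<Sum>i<k. if i = 0 then 0 else mu * (n i w / mu ^ i)) = mu * (\<Sum>i<k. n i w / mu ^ i) - mu * n 0 w"
    unfolding sum.remove[of "{..<k}" 0, OF finite_lessThan, simplified, OF k0]
    by (simp add: sum_distrib_left distrib_left)
  also have "mu * (((\<integral>s. n 0 (w + s) \<partial>P) - (\<Sum>i<k. n i w / mu ^ i)) / mu)
      - ((\<integral>s. n 1 (w + s) \<partial>P) - (mu * (\<Sum>i<k. n i w / mu ^ i) - mu * n 0 w)) / mu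
      = ((\<integral>s. n 0 (w + s) \<partial>P) - (\<integral>s. n 1 (w + s) \<partial>P) / mu) - n 0 w"
    using mu by (simp add: field_simps)
  also have "(\<integral>s. n 0 (w + s) \<partial>P) - (\<integral>s. n 1 (w + s) \<partial>P) / mu = (\<integral>s. f 0 (w + s) \<partial>P)"
    unfolding f0 using int_n[of 0] int_n[of 1] k by simp
  finally have "(\<integral>s. f 0 (w + s) \<partial>P) - n 0 w = (\<integral>s. g s * (mu * u s - u' s) \<partial>lborel)"
    by simp
  moreover have "\<bar>\<integral>s. g s * (mu * u s - u' s) \<partial>lborel\<bar> \<le> B / fact k / mu * C1"
  proof (rule density_by_parts[OF _ g(3,4) u_deriv u_bound k C1])
    show "integrable lborel g"
      using iff[of "\<lambda>_. 1"] by simp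
    show "integrable lborel (\<lambda>s. g s * u s)" "integrable lborel (\<lambda>s. g s * u' s)"
      using iff int_u int_u' by auto
  qed
  ultimately show ?thesis
    by (simp add: n_def)
qed

section \<open>The queue in steady state\<close>

lemma poly_bounded_reflected:
  assumes "poly_bounded p f"
  shows "poly_bounded p (\<lambda>t. f (max 0 (d - t)))"
proof -
  obtain C where C: "C \<ge> 0" "\<And>x t y. \<bar>y\<bar> \<le> \<bar>x\<bar> + \<bar>t\<bar> \<Longrightarrow> \<bar>f y\<bar> \<le> C * ((1 + \<bar>x\<bar>) ^ p * (1 + \<bar>t\<bar>) ^ p)"
    using poly_bounded_le[OF assms] by blast
  have "\<bar>f (max 0 (d - t))\<bar> \<le> (C * (1 + \<bar>d\<bar>) ^ p) * (1 + \<bar>t\<bar>) ^ p" for t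
    using C(2)[of "max 0 (d - t)" d t] by (simp add: mult.assoc)
  with C(1) show ?thesis
    unfolding poly_bounded_def by (intro exI[of _ "C * (1 + \<bar>d\<bar>) ^ p"]) auto
qed

text \<open>Conditioning on an exponential interarrival time: the generator identity of the workload process.\<close>

lemma exp_law_reflected_integral:
  assumes lam: "0 < lam" and K: "\<And>x. (K has_real_derivative m x) (at x)"
    and pb: "poly_bounded p K" "poly_bounded q m" and d: "0 \<le> d"
  shows "lam * (K d - (\<integral>t. K (max 0 (d - t)) \<partial>exp_law lam))
    = (\<integral>t. m (max 0 (d - t)) \<partial>exp_law lam) - m 0 * exp (- lam * d)"
proof -
  have K_cont: "continuous_on A K" for A
    using K by (meson DERIV_isCont continuous_at_imp_continuous_on)
  have [measurable]: "K \<in> borel_measurable borel"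
    by (intro borel_measurable_continuous_onI K_cont)
  have [measurable]: "m \<in> borel_measurable borel"
    using borel_measurable_derivative_on[of K UNIV m] K by simp
  have int_K: "integrable (exp_law lam) (\<lambda>t. K (max 0 (d - t)))"
    using exp_law_poly_integrable[OF lam poly_bounded_reflected[OF pb(1), of d], of 0] by simp
  have int_m: "integrable (exp_law lam) (\<lambda>t. m (max 0 (d - t)))"
    using exp_law_poly_integrable[OF lam poly_bounded_reflected[OF pb(2), of d], of 0] by simp
  let ?h = "\<lambda>t. K (max 0 (d - t)) + m (max 0 (d - t)) / lam"
  \<comment> \<open>Before \<open>d\<close>, the first summand alone is an antiderivative of the
    integrand and the second is constant. After \<open>d\<close> the reflected argument is
    \<open>0\<close>, and the second summand accounts for \<open>m 0\<close>. The
    \<open>max t d\<close> joins both pieces continuously.\<close>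
  let ?G = "\<lambda>t. exp (- lam * t) * K (max 0 (d - t)) + m 0 / lam * exp (- lam * max t d)"
  have "(\<integral>t. ?h t \<partial>exp_law lam) = ?G 0"
  proof (rule exp_law_integral[where G = ?G, OF lam])
    show "integrable (exp_law lam) ?h"
      using int_K int_m by simp
    show "finite {d}"
      by simp
    show "continuous_on {0..} ?G"
      by (intro continuous_intros continuous_on_compose2[OF K_cont[of UNIV]]) auto
    show "(?G has_real_derivative - lam * exp (- lam * t) * ?h t) (at t)" if "0 < t" "t \<notin> {d}" for t
    proof (cases "t < d")
      case True
      have K': "((\<lambda>t. K (d - t)) has_real_derivative m (d - t) * (- 1)) (at t)"
        by (rule DERIV_chain2[OF K]) (auto intro!: derivative_eq_intros)
      have "((\<lambda>t. exp (- lam * t) * K (d - t) + m 0 / lam * exp (- lam * d)) has_real_derivative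
          - lam * exp (- lam * t) * (K (d - t) + m (d - t) / lam)) (at t)"
        using lam by (auto intro!: derivative_eq_intros K' simp: algebra_simps)
      then have "(?G has_real_derivative - lam * exp (- lam * t) * (K (d - t) + m (d - t) / lam)) (at t)"
        by (rule has_field_derivative_transform_within_open[where S = "{..<d}"]) (use True in auto)
      then show ?thesis
        using True by simp
    next
      case False
      then have t: "d < t"
        using that by simp
      have "((\<lambda>t. exp (- lam * t) * K 0 + m 0 / lam * exp (- lam * t)) has_real_derivative
          - lam * exp (- lam * t) * (K 0 + m 0 / lam)) (at t)"
        using lam by (auto intro!: derivative_eq_intros simp: algebra_simps)
      then have "(?G has_real_derivative - lam * exp (- lam * t) * (K 0 + m 0 / lam)) (at t)"
        by (rule has_field_derivative_transform_within_open[where S = "{d<..}"]) (use t in auto)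
      then show ?thesis
        using t by simp
    qed
    have "((\<lambda>t. exp (- lam * t) * (K 0 + m 0 / lam)) \<longlongrightarrow> 0) at_top"
      using lam by real_asymp
    then show "(?G \<longlongrightarrow> 0) at_top"
      by (rule Lim_transform_eventually)
        (use eventually_gt_at_top[of d] in \<open>eventually_elim, auto simp: algebra_simps max_def\<close>)
  qed
  then have "(\<integral>t. K (max 0 (d - t)) \<partial>exp_law lam) + (\<integral>t. m (max 0 (d - t)) \<partial>exp_law lam) / lam
      = K d + m 0 / lam * exp (- lam * d)"
    using int_K int_m d by simp
  then show ?thesis
    using lam by (simp add: field_simps)
qed

text \<open>A drift inequality for one step of the reflected walk: the linear term carries the mean
  of the increment, and the higher binomial terms lose at least two powers of \<open>w\<close>, with
  coefficients adding up to at most \<open>2 ^ (q + 2)\<close>. The bound \<open>y\<close> is kept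
  apart from \<open>\<bar>x\<bar>\<close> so that \<open>x = s - t\<close> can be paired with
  \<open>y = s + t\<close>.\<close>

lemma reflected_power_le:
  fixes w x y :: real
  assumes w: "0 \<le> w" and x: "\<bar>x\<bar> \<le> y"
  shows "max 0 (w + x) ^ (q + 2)
    \<le> w ^ (q + 2) + real (q + 2) * w ^ (q + 1) * x + 2 ^ (q + 2) * ((1 + w) ^ q * (1 + y) ^ (q + 2))"
proof (cases "0 \<le> w + x")
  case True
  let ?t = "\<lambda>j. real (q + 2 choose j) * x ^ j * w ^ (q + 2 - j)"
  have tail: "?t (Suc (Suc j)) \<le> real (q + 2 choose Suc (Suc j)) * ((1 + w) ^ q * (1 + y) ^ (q + 2))" if "j \<le> q" for j
  proof -
    have "x ^ Suc (Suc j) * w ^ (q - j) \<le> \<bar>x\<bar> ^ Suc (Suc j) * w ^ (q - j)"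
      using w by (intro mult_right_mono) (simp_all only: power_abs[symmetric] abs_ge_self zero_le_power)
    also have "\<dots> \<le> (1 + y) ^ (q + 2) * (1 + w) ^ q"
    proof (rule mult_mono)
      have "\<bar>x\<bar> ^ Suc (Suc j) \<le> (1 + y) ^ Suc (Suc j)"
        using x by (intro power_mono) auto
      also have "\<dots> \<le> (1 + y) ^ (q + 2)"
        using that x by (intro power_increasing) auto
      finally show "\<bar>x\<bar> ^ Suc (Suc j) \<le> (1 + y) ^ (q + 2)" .
      have "w ^ (q - j) \<le> (1 + w) ^ (q - j)"
        using w by (intro power_mono) auto
      also have "\<dots> \<le> (1 + w) ^ q"
        using w by (intro power_increasing) auto
      finally show "w ^ (q - j) \<le> (1 + w) ^ q" .
    qed (use w x in auto)
    finally have "real (q + 2 choose Suc (Suc j)) * (x ^ Suc (Suc j) * w ^ (q - j))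
        \<le> real (q + 2 choose Suc (Suc j)) * ((1 + y) ^ (q + 2) * (1 + w) ^ q)"
      by (intro mult_left_mono) auto
    then show ?thesis
      by (simp add: mult_ac)
  qed
  have "(\<Sum>j\<le>q. real (q + 2 choose Suc (Suc j))) \<le> (\<Sum>j\<le>Suc (Suc q). real (q + 2 choose j))"
    unfolding sum.atMost_Suc_shift by simp
  also have "\<dots> = 2 ^ (q + 2)"
    using choose_row_sum[of "q + 2"] by (simp flip: of_nat_sum)
  finally have choose: "(\<Sum>j\<le>q. real (q + 2 choose Suc (Suc j))) \<le> 2 ^ (q + 2)" .
  have "max 0 (w + x) ^ (q + 2) = (x + w) ^ (q + 2)"
    using True by (simp add: add.commute)
  also have "\<dots> = (\<Sum>j\<le>Suc (Suc q). ?t j)"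
    by (subst binomial_ring) simp
  also have "\<dots> = w ^ (q + 2) + real (q + 2) * w ^ (q + 1) * x + (\<Sum>j\<le>q. ?t (Suc (Suc j)))"
    unfolding sum.atMost_Suc_shift by simp
  also have "(\<Sum>j\<le>q. ?t (Suc (Suc j))) \<le> (\<Sum>j\<le>q. real (q + 2 choose Suc (Suc j)) * ((1 + w) ^ q * (1 + y) ^ (q + 2)))"
    by (intro sum_mono tail) auto
  also have "\<dots> \<le> 2 ^ (q + 2) * ((1 + w) ^ q * (1 + y) ^ (q + 2))"
    unfolding sum_distrib_right[symmetric] using choose w x by (intro mult_right_mono) auto
  finally show ?thesis
    by simp
next
  \<comment> \<open>Now the left side is \<open>0\<close>, but the linear term is negative. Since
    \<open>w < - x \<le> y\<close>, one factor \<open>w\<close> can be traded for \<open>y\<close>,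
    which brings it under the error term.\<close>
  case False
  have y: "0 \<le> y"
    using x by linarith
  have "real (q + 2) * w ^ (q + 1) * (- x) \<le> 2 ^ (q + 2) * ((1 + w) ^ q * (1 + y) ^ (q + 2))"
  proof -
    have "w ^ (q + 1) * (- x) = w ^ q * (w * (- x))"
      by simp
    also have "\<dots> \<le> (1 + w) ^ q * (1 + y) ^ (q + 2)"
    proof (rule mult_mono)
      have "w * (- x) \<le> (1 + y) * (1 + y)"
        using w x False by (intro mult_mono) auto
      also have "\<dots> \<le> (1 + y) ^ (q + 2)"
        using y power_increasing[of 2 "q + 2" "1 + y"] by (simp add: power2_eq_square)
      finally show "w * (- x) \<le> (1 + y) ^ (q + 2)" .
      show "w ^ q \<le> (1 + w) ^ q"
        using w by (intro power_mono) auto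
      show "0 \<le> w * - x"
        using w False by (intro mult_nonneg_nonneg) auto
    qed (use w in auto)
    finally have *: "w ^ (q + 1) * (- x) \<le> (1 + w) ^ q * (1 + y) ^ (q + 2)" .
    have "real (q + 2) * (w ^ (q + 1) * (- x)) \<le> 2 ^ (q + 2) * ((1 + w) ^ q * (1 + y) ^ (q + 2))"
    proof (rule mult_mono[OF _ *])
      show "real (q + 2) \<le> 2 ^ (q + 2)"
        by (rule less_imp_le[OF of_nat_less_two_power])
      have "0 \<le> w ^ (q + 1) * (- x)"
        using w False by (intro mult_nonneg_nonneg) auto
      then show "0 \<le> w ^ (q + 1) * - x" .
    qed auto
    then show ?thesis
      by (simp only: mult.assoc)
  qed
  moreover have "max 0 (w + x) ^ (q + 2) = 0"
    using False by simp
  moreover have "0 \<le> w ^ (q + 2)"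
    using w by simp
  ultimately show ?thesis
    by (simp only: mult_minus_right)
qed

text \<open>Beyond the threshold \<open>R\<close> one has \<open>1 + w \<le> 2 * w\<close> and
  \<open>c * 2 ^ q \<le> \<kappa> * w\<close>, so the higher power wins; below it the left side is
  bounded by its value at \<open>R\<close>.\<close>

lemma power_absorb:
  assumes \<kappa>: "0 < (\<kappa>::real)" and c: "0 \<le> c"
  obtains c' where "\<And>w. 0 \<le> w \<Longrightarrow> c * (1 + w) ^ q \<le> \<kappa> * w ^ (q + 1) + c'"
proof -
  define R where "R = max 1 (c * 2 ^ q / \<kappa>)"
  have "c * (1 + w) ^ q \<le> \<kappa> * w ^ (q + 1) + c * (1 + R) ^ q" if w: "0 \<le> w" for w
  proof (cases "w \<le> R")
    case True
    then have "c * (1 + w) ^ q \<le> c * (1 + R) ^ q"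
      using w c by (intro mult_left_mono power_mono) auto
    moreover have "0 \<le> \<kappa> * w ^ (q + 1)"
      using w \<kappa> by (intro mult_nonneg_nonneg) auto
    ultimately show ?thesis
      by linarith
  next
    case False
    then have w1: "1 \<le> w" and wR: "c * 2 ^ q \<le> \<kappa> * w"
      using \<kappa> by (simp_all add: R_def less_imp_le pos_divide_less_eq mult.commute not_le)
    have "c * (1 + w) ^ q \<le> c * (2 * w) ^ q"
      using w1 c by (intro mult_left_mono power_mono) auto
    also have "\<dots> = (c * 2 ^ q) * w ^ q"
      by (simp add: power_mult_distrib)
    also have "\<dots> \<le> (\<kappa> * w) * w ^ q"
      using wR w by (intro mult_right_mono) auto
    finally have "c * (1 + w) ^ q \<le> \<kappa> * w ^ (q + 1)"
      by simp
    moreover have "0 \<le> c * (1 + R) ^ q"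
      using c by (simp add: R_def)
    ultimately show ?thesis
      by linarith
  qed
  then show ?thesis
    using that by blast
qed

text \<open>Stationarity as two fixed-point equations between laws: \<open>\<sigma>\<close> of the
  service, \<open>\<delta>\<close> of the sojourn and \<open>\<omega>\<close> of the waiting time.
  The product measures express the independence of the variables that are combined.\<close>

locale steady_state =
  fixes lam :: real and \<sigma> \<delta> \<omega> :: "real measure"
  assumes lam: "0 < lam"
    and service: "prob_space \<sigma>" "sets \<sigma> = sets borel" "AE s in \<sigma>. 0 \<le> s"
    and sojourn: "prob_space \<delta>" "sets \<delta> = sets borel"
    and wait_eq: "\<omega> = distr (\<delta> \<Otimes>\<^sub>M exp_law lam) borel (\<lambda>(d, t). max 0 (d - t))"
    and sojourn_eq: "\<delta> = distr (\<omega> \<Otimes>\<^sub>M \<sigma>) borel (\<lambda>(w, s). w + s)"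
begin

lemma sets_wait: "sets \<omega> = sets borel"
  by (subst wait_eq) simp

lemmas [measurable_cong, simp] = service(2) sojourn(2) sets_wait

sublocale S: prob_space \<sigma>
  by (rule service(1))

sublocale D: prob_space \<delta>
  by (rule sojourn(1))

sublocale T: prob_space "exp_law lam"
  by (rule prob_space_exp_law[OF lam])

sublocale DT: pair_prob_space \<delta> "exp_law lam" ..

sublocale W: prob_space \<omega>
  by (subst wait_eq, rule DT.prob_space_distr) measurable

sublocale WS: pair_prob_space \<omega> \<sigma> ..

sublocale ST: pair_prob_space \<sigma> "exp_law lam" ..

lemma wait_nonneg: "AE w in \<omega>. 0 \<le> w"
  by (subst wait_eq, subst AE_distr_iff) auto

lemma sojourn_nonneg: "AE d in \<delta>. 0 \<le> d"
proof -
  have "AE p in \<omega> \<Otimes>\<^sub>M \<sigma>. 0 \<le> fst p + snd p"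
  proof (intro WS.AE_pair_measure)
    show "AE w in \<omega>. AE s in \<sigma>. 0 \<le> fst (w, s) + snd (w, s)"
      using wait_nonneg
    proof eventually_elim
      case (elim w)
      show ?case
        using service(3) by eventually_elim (use elim in auto)
    qed
  qed measurable
  then show ?thesis
    by (subst sojourn_eq, subst AE_distr_iff) (auto simp: case_prod_beta)
qed

lemma integral_wait:
  fixes f :: "real \<Rightarrow> real"
  assumes "integrable \<omega> f"
  shows "(\<integral>w. f w \<partial>\<omega>) = (\<integral>d. \<integral>t. f (max 0 (d - t)) \<partial>exp_law lam \<partial>\<delta>)"
    and "integrable \<delta> (\<lambda>d. \<integral>t. f (max 0 (d - t)) \<partial>exp_law lam)"
proof -
  have [measurable]: "f \<in> borel_measurable borel"
    using borel_measurable_integrable[OF assms] by (simp add: measurable_cong_sets[OF sets_wait refl])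
  have int: "integrable (\<delta> \<Otimes>\<^sub>M exp_law lam) (\<lambda>p. f (max 0 (fst p - snd p)))"
    using assms by (subst (asm) wait_eq, subst (asm) integrable_distr_eq) (auto simp: case_prod_beta)
  have "(\<integral>w. f w \<partial>\<omega>) = (\<integral>p. f (max 0 (fst p - snd p)) \<partial>(\<delta> \<Otimes>\<^sub>M exp_law lam))"
    by (subst wait_eq, subst integral_distr) (auto simp: case_prod_beta)
  also have "\<dots> = (\<integral>d. \<integral>t. f (max 0 (d - t)) \<partial>exp_law lam \<partial>\<delta>)"
    using DT.integral_fst'[OF int] by simp
  finally show "(\<integral>w. f w \<partial>\<omega>) = (\<integral>d. \<integral>t. f (max 0 (d - t)) \<partial>exp_law lam \<partial>\<delta>)" .
  show "integrable \<delta> (\<lambda>d. \<integral>t. f (max 0 (d - t)) \<partial>exp_law lam)"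
    using DT.integrable_fst'[OF int] by simp
qed

lemma integral_sojourn:
  fixes f :: "real \<Rightarrow> real"
  assumes "integrable \<delta> f"
  shows "(\<integral>d. f d \<partial>\<delta>) = (\<integral>w. \<integral>s. f (w + s) \<partial>\<sigma> \<partial>\<omega>)"
    and "integrable \<omega> (\<lambda>w. \<integral>s. f (w + s) \<partial>\<sigma>)"
proof -
  have [measurable]: "f \<in> borel_measurable borel"
    using borel_measurable_integrable[OF assms] by (simp add: measurable_cong_sets[OF sojourn(2) refl])
  have int: "integrable (\<omega> \<Otimes>\<^sub>M \<sigma>) (\<lambda>p. f (fst p + snd p))"
    using assms by (subst (asm) sojourn_eq, subst (asm) integrable_distr_eq) (auto simp: case_prod_beta)
  have "(\<integral>d. f d \<partial>\<delta>) = (\<integral>p. f (fst p + snd p) \<partial>(\<omega> \<Otimes>\<^sub>M \<sigma>))"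
    by (subst sojourn_eq, subst integral_distr) (auto simp: case_prod_beta)
  also have "\<dots> = (\<integral>w. \<integral>s. f (w + s) \<partial>\<sigma> \<partial>\<omega>)"
    using WS.integral_fst'[OF int] by simp
  finally show "(\<integral>d. f d \<partial>\<delta>) = (\<integral>w. \<integral>s. f (w + s) \<partial>\<sigma> \<partial>\<omega>)" .
  show "integrable \<omega> (\<lambda>w. \<integral>s. f (w + s) \<partial>\<sigma>)"
    using WS.integrable_fst'[OF int] by simp
qed

lemma integrable_pair_product:
  fixes f g :: "real \<Rightarrow> real"
  assumes "integrable \<omega> f" "integrable \<sigma> g"
  shows "integrable (\<omega> \<Otimes>\<^sub>M \<sigma>) (\<lambda>p. f (fst p) * g (snd p))"
proof (rule WS.Fubini_integrable)
  have [measurable]: "f \<in> borel_measurable \<omega>" "g \<in> borel_measurable \<sigma>"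
    using assms by auto
  show "(\<lambda>p. f (fst p) * g (snd p)) \<in> borel_measurable (\<omega> \<Otimes>\<^sub>M \<sigma>)"
    by measurable
qed (use assms in \<open>auto simp: abs_mult\<close>)

lemma sojourn_power_integrable:
  assumes "integrable \<omega> (\<lambda>w. w ^ p)" "integrable \<sigma> (\<lambda>s. s ^ p)"
  shows "integrable \<delta> (\<lambda>d. d ^ p)"
proof -
  have 1: "integrable \<omega> (\<lambda>w. (1 + w) ^ p)"
    by (rule integrable_power_of_nonneg[OF _ _ assms(1) wait_nonneg order_refl]) (auto simp: W.finite_measure_axioms)
  have 2: "integrable \<sigma> (\<lambda>s. (1 + s) ^ p)"
    by (rule integrable_power_of_nonneg[OF _ _ assms(2) service(3) order_refl]) (auto simp: S.finite_measure_axioms)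
  have "integrable (\<omega> \<Otimes>\<^sub>M \<sigma>) (\<lambda>p'. (fst p' + snd p') ^ p)"
  proof (rule Bochner_Integration.integrable_bound[OF integrable_pair_product[OF 1 2]])
    show "AE p' in \<omega> \<Otimes>\<^sub>M \<sigma>. norm ((fst p' + snd p') ^ p) \<le> norm ((1 + fst p') ^ p * (1 + snd p') ^ p)"
    proof (intro WS.AE_pair_measure)
      have le: "norm ((w + s) ^ p) \<le> norm ((1 + w) ^ p * (1 + s) ^ p)" if "0 \<le> w" "0 \<le> s" for w s :: real
      proof -
        have "w + s \<le> (1 + w) * (1 + s)"
          using mult_nonneg_nonneg[OF that] by (simp add: algebra_simps)
        then have "(w + s) ^ p \<le> ((1 + w) * (1 + s)) ^ p"
          using that by (intro power_mono) auto
        then show ?thesis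
          using that by (simp add: power_mult_distrib)
      qed
      show "AE w in \<omega>. AE s in \<sigma>. norm ((fst (w, s) + snd (w, s)) ^ p) \<le> norm ((1 + fst (w, s)) ^ p * (1 + snd (w, s)) ^ p)"
        using wait_nonneg
      proof eventually_elim
        case (elim w)
        show ?case
          using service(3) by eventually_elim (use le elim in auto)
      qed
    qed measurable
  qed measurable
  then show ?thesis
    by (subst sojourn_eq, subst integrable_distr_eq) (auto simp: case_prod_beta)
qed

text \<open>Both fixed-point equations joined into one step of the walk with increment
  \<open>S - T\<close>. Bounded test functions keep this applicable before any moment of the waiting
  time is known to exist.\<close>

lemma bounded_stationarity:
  fixes f :: "real \<Rightarrow> real"
  assumes [measurable]: "f \<in> borel_measurable borel" and f: "\<And>x. \<bar>f x\<bar> \<le> B"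
  shows "(\<integral>w. f w \<partial>\<omega>) = (\<integral>w. \<integral>p. f (max 0 (w + (fst p - snd p))) \<partial>(\<sigma> \<Otimes>\<^sub>M exp_law lam) \<partial>\<omega>)"
    and "integrable \<omega> (\<lambda>w. \<integral>p. f (max 0 (w + (fst p - snd p))) \<partial>(\<sigma> \<Otimes>\<^sub>M exp_law lam))"
proof -
  have int: "integrable \<omega> f"
    by (rule W.integrable_const_bound[where B = B]) (use f in auto)
  note d = integral_sojourn[OF integral_wait(2)[OF int]]
  have "(\<integral>t. f (max 0 (w + s - t)) \<partial>exp_law lam) = (\<integral>t. f (max 0 (w + (s - t))) \<partial>exp_law lam)" for w s
    by (simp add: algebra_simps)
  moreover have "(\<integral>s. \<integral>t. f (max 0 (w + (s - t))) \<partial>exp_law lam \<partial>\<sigma>)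
      = (\<integral>p. f (max 0 (w + (fst p - snd p))) \<partial>(\<sigma> \<Otimes>\<^sub>M exp_law lam))" for w
  proof -
    have "integrable (\<sigma> \<Otimes>\<^sub>M exp_law lam) (\<lambda>p. f (max 0 (w + (fst p - snd p))))"
      by (rule ST.P.integrable_const_bound[where B = B]) (use f in auto)
    from ST.integral_fst'[OF this] show ?thesis
      by simp
  qed
  ultimately show "(\<integral>w. f w \<partial>\<omega>) = (\<integral>w. \<integral>p. f (max 0 (w + (fst p - snd p))) \<partial>(\<sigma> \<Otimes>\<^sub>M exp_law lam) \<partial>\<omega>)"
    and "integrable \<omega> (\<lambda>w. \<integral>p. f (max 0 (w + (fst p - snd p))) \<partial>(\<sigma> \<Otimes>\<^sub>M exp_law lam))"
    using d unfolding integral_wait(1)[OF int] by simp_all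
qed

text \<open>Stationarity tested on the truncated power \<open>min(w,a)\<^bsup>q+2\<^esup>\<close>: the negative drift of \<open>S - T\<close> bounds the
  truncated moment of order \<open>q + 1\<close> uniformly in \<open>a\<close>.\<close>

lemma truncated_moment_le:
  assumes load: "lam * (\<integral>s. s \<partial>\<sigma>) < 1" and moment: "integrable \<sigma> (\<lambda>s. s ^ (q + 2))"
  obtains C where "\<And>a. 0 < a \<Longrightarrow> (\<integral>w. indicator {0..<a} w * w ^ (q + 1) \<partial>\<omega>) \<le> C"
proof -
  let ?\<nu> = "\<sigma> \<Otimes>\<^sub>M exp_law lam"
  have S1: "integrable \<sigma> (\<lambda>s. s)"
    using integrable_power_le[OF _ service(2,3) moment, of 1] by (simp add: S.finite_measure_axioms)
  have T1: "integrable (exp_law lam) (\<lambda>t. t)" "(\<integral>t. t \<partial>exp_law lam) = 1 / lam"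
    using exp_law_power_moment[OF lam, of 1] by simp_all
  have prod: "integrable ?\<nu> (\<lambda>p. f (fst p) * h (snd p))"
    if "integrable \<sigma> f" "integrable (exp_law lam) h" for f h :: "real \<Rightarrow> real"
  proof (rule ST.Fubini_integrable)
    have [measurable]: "f \<in> borel_measurable \<sigma>" "h \<in> borel_measurable (exp_law lam)"
      using that by auto
    show "(\<lambda>p. f (fst p) * h (snd p)) \<in> borel_measurable ?\<nu>"
      by measurable
  qed (use that in \<open>auto simp: abs_mult\<close>)
  have X1: "integrable ?\<nu> (\<lambda>p. fst p - snd p)"
    using prod[OF S1, of "\<lambda>_. 1"] prod[OF _ T1(1), of "\<lambda>_. 1"] by auto
  have EX: "(\<integral>p. fst p - snd p \<partial>?\<nu>) = (\<integral>s. s \<partial>\<sigma>) - 1 / lam"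
    using ST.integral_fst'[OF X1] S1 T1 T.prob_space S.prob_space by simp
  define \<kappa> where "\<kappa> = 1 / lam - (\<integral>s. s \<partial>\<sigma>)"
  have \<kappa>: "0 < \<kappa>"
    using load lam by (simp add: \<kappa>_def field_simps)
  have 2: "integrable \<sigma> (\<lambda>s. (1 + s) ^ (q + 2))"
    by (rule integrable_power_of_nonneg[OF _ _ moment service(3) order_refl]) (auto simp: S.finite_measure_axioms)
  let ?Y = "\<lambda>p. (1 + fst p) ^ (q + 2) * (1 + snd p) ^ (q + 2) :: real"
  have intY: "integrable ?\<nu> ?Y"
    by (rule prod[OF 2 exp_law_one_plus_power_integrable[OF lam]])
  have nn: "AE p in ?\<nu>. 0 \<le> fst p \<and> 0 \<le> snd p"
  proof (intro ST.AE_pair_measure)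
    show "AE s in \<sigma>. AE t in exp_law lam. 0 \<le> fst (s, t) \<and> 0 \<le> snd (s, t)"
      using service(3)
    proof eventually_elim
      case (elim s)
      show ?case
        using AE_exp_law_nonneg[of lam] by eventually_elim (use elim in auto)
    qed
  qed measurable
  define c where "c = 2 ^ (q + 2) * (\<integral>p. ?Y p \<partial>?\<nu>)"
  have "0 \<le> (\<integral>p. ?Y p \<partial>?\<nu>)"
    by (rule integral_nonneg_AE) (use nn in \<open>eventually_elim, simp\<close>)
  then have c: "0 \<le> c"
    by (simp add: c_def)
  obtain c' where c': "\<And>w. 0 \<le> w \<Longrightarrow> c * (1 + w) ^ q \<le> \<kappa> * w ^ (q + 1) + c'"
    using power_absorb[OF \<kappa> c] by blast
  have c'_nonneg: "0 \<le> c'"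
    using c'[of 0] c by (simp add: zero_power)
  have "(\<integral>w. indicator {0..<a} w * w ^ (q + 1) \<partial>\<omega>) \<le> c' / \<kappa>" if a: "0 < a" for a
  proof -
    let ?\<phi> = "\<lambda>w. min (max 0 w) a ^ (q + 2)"
    have \<phi>_bound: "\<bar>?\<phi> w\<bar> \<le> a ^ (q + 2)" for w
      unfolding power_abs using a by (intro power_mono) auto
    have \<phi>_le: "?\<phi> (max 0 (w + x)) \<le> max 0 (w + x) ^ (q + 2)" for w x
      using a by (intro power_mono) auto
    let ?A = "\<lambda>w. \<integral>p. ?\<phi> (max 0 (w + (fst p - snd p))) \<partial>?\<nu>"
    let ?J = "indicator {0..<a} :: real \<Rightarrow> real"
    have A_int: "integrable ?\<nu> (\<lambda>p. ?\<phi> (max 0 (w + (fst p - snd p))))" for w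
      by (rule ST.P.integrable_const_bound[where B = "a ^ (q + 2)"]) (use \<phi>_bound in auto)
    have step: "?A w \<le> ?\<phi> w + ?J w * (c' - \<kappa> * w ^ (q + 1))" if w: "0 \<le> w" for w
    proof (cases "w < a")
      case True
      have "?A w \<le> (\<integral>p. w ^ (q + 2) + real (q + 2) * w ^ (q + 1) * (fst p - snd p) + 2 ^ (q + 2) * ((1 + w) ^ q * ?Y p) \<partial>?\<nu>)"
      proof (rule integral_mono_AE[OF A_int])
        show "integrable ?\<nu> (\<lambda>p. w ^ (q + 2) + real (q + 2) * w ^ (q + 1) * (fst p - snd p) + 2 ^ (q + 2) * ((1 + w) ^ q * ?Y p))"
          by (intro Bochner_Integration.integrable_add integrable_mult_right X1 intY ST.P.integrable_const)
        show "AE p in ?\<nu>. ?\<phi> (max 0 (w + (fst p - snd p)))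
            \<le> w ^ (q + 2) + real (q + 2) * w ^ (q + 1) * (fst p - snd p) + 2 ^ (q + 2) * ((1 + w) ^ q * ?Y p)"
          using nn
        proof eventually_elim
          case (elim p)
          have "max 0 (w + (fst p - snd p)) ^ (q + 2)
              \<le> w ^ (q + 2) + real (q + 2) * w ^ (q + 1) * (fst p - snd p)
                + 2 ^ (q + 2) * ((1 + w) ^ q * (1 + (fst p + snd p)) ^ (q + 2))"
            using elim by (intro reflected_power_le w) auto
          moreover have "(1 + (fst p + snd p)) ^ (q + 2) \<le> ?Y p"
            unfolding power_mult_distrib[symmetric]
            using elim mult_nonneg_nonneg[of "fst p" "snd p"] by (intro power_mono) (auto simp: algebra_simps)
          then have "2 ^ (q + 2) * ((1 + w) ^ q * (1 + (fst p + snd p)) ^ (q + 2)) \<le> 2 ^ (q + 2) * ((1 + w) ^ q * ?Y p)"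
            using w by (intro mult_left_mono) auto
          ultimately show ?case
            using \<phi>_le[of w "fst p - snd p"] by linarith
        qed
      qed
      also have "\<dots> = w ^ (q + 2) + real (q + 2) * w ^ (q + 1) * (\<integral>p. fst p - snd p \<partial>?\<nu>) + 2 ^ (q + 2) * ((1 + w) ^ q * (\<integral>p. ?Y p \<partial>?\<nu>))"
        using X1 intY by (simp add: ST.P.prob_space)
      also have "\<dots> = w ^ (q + 2) - real (q + 2) * (\<kappa> * w ^ (q + 1)) + c * (1 + w) ^ q"
        unfolding EX by (simp add: \<kappa>_def c_def algebra_simps add_divide_distrib)
      finally have "?A w \<le> w ^ (q + 2) - real (q + 2) * (\<kappa> * w ^ (q + 1)) + c * (1 + w) ^ q" .
      \<comment> \<open>Two of the \<open>q + 2\<close> copies of the drift are kept: one absorbs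
        the error term through \<open>c'\<close>, the other remains in the conclusion.\<close>
      moreover have "2 * (\<kappa> * w ^ (q + 1)) \<le> real (q + 2) * (\<kappa> * w ^ (q + 1))"
        using w \<kappa> by (intro mult_right_mono mult_nonneg_nonneg) auto
      ultimately have "?A w \<le> w ^ (q + 2) + (c' - \<kappa> * w ^ (q + 1))"
        using c'[OF w] by linarith
      then show ?thesis
        using True w by simp
    next
      \<comment> \<open>At or above the level \<open>a\<close> the truncated power already has its
        maximal value, so one step cannot raise its mean.\<close>
      case False
      have "?A w \<le> (\<integral>p. a ^ (q + 2) \<partial>?\<nu>)"
        using \<phi>_bound by (intro integral_mono A_int) (auto intro: order_trans[OF abs_ge_self])
      also have "\<dots> = a ^ (q + 2)"
        by (simp add: ST.P.prob_space)
      also have "\<dots> = ?\<phi> w + ?J w * (c' - \<kappa> * w ^ (q + 1))"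
        using False a by (simp add: min_absorb2)
      finally show ?thesis .
    qed
    have \<phi>_int: "integrable \<omega> ?\<phi>"
      by (rule W.integrable_const_bound[where B = "a ^ (q + 2)"]) (use \<phi>_bound in auto)
    have J_int: "integrable \<omega> (\<lambda>w. ?J w * w ^ (q + 1))"
    proof (rule W.integrable_const_bound[where B = "a ^ (q + 1)"])
      show "AE w in \<omega>. norm (?J w * w ^ (q + 1)) \<le> a ^ (q + 1)"
        using a by (intro AE_I2) (auto simp: indicator_def simp del: power_Suc intro!: power_mono)
    qed measurable
    have J1_int: "integrable \<omega> ?J"
      by (rule W.integrable_const_bound[where B = 1]) (auto simp: indicator_def)
    have "(\<integral>w. ?\<phi> w \<partial>\<omega>) = (\<integral>w. ?A w \<partial>\<omega>)"
      by (rule bounded_stationarity(1)[OF _ \<phi>_bound]) measurable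
    also have "\<dots> \<le> (\<integral>w. ?\<phi> w + (c' * ?J w - \<kappa> * (?J w * w ^ (q + 1))) \<partial>\<omega>)"
    proof (rule integral_mono_AE)
      show "integrable \<omega> ?A"
        by (rule bounded_stationarity(2)[OF _ \<phi>_bound]) measurable
      show "AE w in \<omega>. ?A w \<le> ?\<phi> w + (c' * ?J w - \<kappa> * (?J w * w ^ (q + 1)))"
        using wait_nonneg
      proof eventually_elim
        case (elim w)
        show ?case
          using step[OF elim] by (simp add: algebra_simps)
      qed
    qed (intro Bochner_Integration.integrable_add Bochner_Integration.integrable_diff integrable_mult_right \<phi>_int J1_int J_int)
    also have "\<dots> = (\<integral>w. ?\<phi> w \<partial>\<omega>) + (c' * (\<integral>w. ?J w \<partial>\<omega>) - \<kappa> * (\<integral>w. ?J w * w ^ (q + 1) \<partial>\<omega>))"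
      using \<phi>_int J_int J1_int by simp
    \<comment> \<open>The integral of \<open>?\<phi>\<close> stands on both sides by stationarity
      and is finite by truncation, hence cancels.\<close>
    finally have "\<kappa> * (\<integral>w. ?J w * w ^ (q + 1) \<partial>\<omega>) \<le> c' * (\<integral>w. ?J w \<partial>\<omega>)"
      by simp
    also have "\<dots> \<le> c' * 1"
      using c'_nonneg by (intro mult_left_mono) (auto simp: W.prob_le_1)
    finally show ?thesis
      using \<kappa> by (simp add: field_simps)
  qed
  then show ?thesis
    using that by blast
qed

text \<open>The truncated bound is uniform in the level, so monotone convergence applies. Service
  moments of order \<open>q + 2\<close> yield waiting moments of order \<open>q + 1\<close>: the
  drift multiplies a derivative, which costs one order.\<close>

lemma wait_moment:
  assumes load: "lam * (\<integral>s. s \<partial>\<sigma>) < 1" and moment: "integrable \<sigma> (\<lambda>s. s ^ (q + 2))"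
  shows "integrable \<omega> (\<lambda>w. w ^ (q + 1))"
proof -
  obtain C where C: "\<And>a. 0 < a \<Longrightarrow> (\<integral>w. indicator {0..<a} w * w ^ (q + 1) \<partial>\<omega>) \<le> C"
    using truncated_moment_le[OF assms] by blast
  let ?J = "\<lambda>n w. indicator {0..<real (Suc n)} w * w ^ (q + 1) :: real"
  have J_int: "integrable \<omega> (?J n)" for n
  proof (rule W.integrable_const_bound[where B = "real (Suc n) ^ (q + 1)"])
    show "AE w in \<omega>. norm (?J n w) \<le> real (Suc n) ^ (q + 1)"
      by (intro AE_I2) (auto simp: indicator_def simp del: power_Suc of_nat_Suc intro!: power_mono)
  qed measurable
  have J_nonneg: "0 \<le> ?J n w" for n w
    by (auto simp: indicator_def)
  have lim: "(SUP n. ennreal (?J n w)) = ennreal (w ^ (q + 1))" if "0 \<le> w" for w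
  proof (rule antisym)
    show "(SUP n. ennreal (?J n w)) \<le> ennreal (w ^ (q + 1))"
      using that by (intro SUP_least ennreal_leI) (auto simp: indicator_def)
    obtain n where "w < real n"
      using reals_Archimedean2 by blast
    then have "w < real (Suc n)"
      by simp
    then have "?J n w = w ^ (q + 1)"
      using that by (simp del: of_nat_Suc)
    then show "ennreal (w ^ (q + 1)) \<le> (SUP n. ennreal (?J n w))"
      using SUP_upper[of n UNIV "\<lambda>n. ennreal (?J n w)"] by (simp only: UNIV_I simp_thms)
  qed
  have "(\<integral>\<^sup>+w. ennreal (norm (w ^ (q + 1))) \<partial>\<omega>) = (\<integral>\<^sup>+w. (SUP n. ennreal (?J n w)) \<partial>\<omega>)"
    using wait_nonneg by (intro nn_integral_cong_AE, eventually_elim) (simp only: lim, simp)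
  also have "\<dots> = (SUP n. \<integral>\<^sup>+w. ennreal (?J n w) \<partial>\<omega>)"
  proof (rule nn_integral_monotone_convergence_SUP)
    show "incseq (\<lambda>n w. ennreal (?J n w))"
      by (intro incseq_SucI le_funI ennreal_leI) (auto simp: indicator_def)
  qed measurable
  also have "\<dots> \<le> ennreal C"
    using C J_nonneg by (intro SUP_least, subst nn_integral_eq_integral[OF J_int]) (auto intro!: ennreal_leI)
  finally show ?thesis
    by (auto simp: integrable_iff_bounded less_top[symmetric] top_unique)
qed

end

section \<open>The balance equation and the distance bound for the stationary laws\<close>

context steady_state
begin

lemma wait_poly_integrable:
  assumes "poly_bounded p f" "f \<in> borel_measurable borel" "integrable \<omega> (\<lambda>w. w ^ q)" "p \<le> q"
  shows "integrable \<omega> f"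
  using poly_bounded_integrable[OF assms(1,2) sets_wait
      integrable_power_of_nonneg[OF _ _ assms(3) wait_nonneg assms(4)] wait_nonneg, of 0]
  by (simp add: W.finite_measure_axioms)

lemma sojourn_poly_integrable:
  assumes "poly_bounded p f" "f \<in> borel_measurable borel"
    and "integrable \<omega> (\<lambda>w. w ^ q)" "integrable \<sigma> (\<lambda>s. s ^ q)" "p \<le> q"
  shows "integrable \<delta> f"
  using poly_bounded_integrable[OF assms(1,2) sojourn(2)
      integrable_power_of_nonneg[OF _ _ sojourn_power_integrable[OF assms(3,4)] sojourn_nonneg assms(5)] sojourn_nonneg, of 0]
  by (simp add: D.finite_measure_axioms)

text \<open>The identity conditional on \<open>d\<close> is integrated over \<open>\<delta>\<close>;
  the inner averages become expectations under \<open>\<omega>\<close>, the law of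
  \<open>max 0 (d - t)\<close>.\<close>

lemma workload_balance:
  assumes K: "\<And>x. (K has_real_derivative m x) (at x)" and m: "poly_bounded p m"
    and q: "integrable \<omega> (\<lambda>w. w ^ q)" "integrable \<sigma> (\<lambda>s. s ^ q)" "p + 1 \<le> q"
  shows "lam * ((\<integral>d. K d \<partial>\<delta>) - (\<integral>w. K w \<partial>\<omega>)) = (\<integral>w. m w \<partial>\<omega>) - m 0 * (\<integral>d. exp (- lam * d) \<partial>\<delta>)"
proof -
  have pb: "poly_bounded (Suc p) K"
    by (rule poly_bounded_antiderivative[OF m K])
  have [measurable]: "K \<in> borel_measurable borel"
    using K by (intro borel_measurable_continuous_onI continuous_at_imp_continuous_on) (auto intro: DERIV_isCont)
  have [measurable]: "m \<in> borel_measurable borel"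
    using borel_measurable_derivative_on[of K UNIV m] K by simp
  have KW: "integrable \<omega> K"
    by (rule wait_poly_integrable[OF pb _ q(1)]) (use q in auto)
  have KD: "integrable \<delta> K"
    by (rule sojourn_poly_integrable[OF pb _ q(1,2)]) (use q in auto)
  have mW: "integrable \<omega> m"
    by (rule wait_poly_integrable[OF m _ q(1)]) (use q in auto)
  have eD: "integrable \<delta> (\<lambda>d. exp (- lam * d))"
  proof (rule D.integrable_const_bound[where B = 1])
    show "AE d in \<delta>. norm (exp (- lam * d)) \<le> 1"
      using sojourn_nonneg by eventually_elim (use lam in auto)
  qed measurable
  have "(\<integral>d. lam * (K d - (\<integral>t. K (max 0 (d - t)) \<partial>exp_law lam)) \<partial>\<delta>)
      = (\<integral>d. (\<integral>t. m (max 0 (d - t)) \<partial>exp_law lam) - m 0 * exp (- lam * d) \<partial>\<delta>)"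
  proof (rule integral_cong_AE)
    show "AE d in \<delta>. lam * (K d - (\<integral>t. K (max 0 (d - t)) \<partial>exp_law lam))
        = (\<integral>t. m (max 0 (d - t)) \<partial>exp_law lam) - m 0 * exp (- lam * d)"
      using sojourn_nonneg by eventually_elim (rule exp_law_reflected_integral[OF lam K pb m])
  qed (use integral_wait(2)[OF KW] integral_wait(2)[OF mW] KD eD in auto)
  then show ?thesis
    unfolding integral_wait(1)[OF KW] integral_wait(1)[OF mW]
    using integral_wait(2)[OF KW] integral_wait(2)[OF mW] KD eD by simp
qed

text \<open>The balance equation for \<open>K x = x\<close>, where the difference of the means of
  \<open>\<delta>\<close> and \<open>\<omega>\<close> is the mean service time. The left side is the
  probability that an independent interarrival time exceeds the sojourn time.\<close>

lemma sojourn_laplace: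
  assumes "integrable \<omega> (\<lambda>w. w)" "integrable \<sigma> (\<lambda>s. s)"
  shows "(\<integral>d. exp (- lam * d) \<partial>\<delta>) = 1 - lam * (\<integral>s. s \<partial>\<sigma>)"
proof -
  have pb: "poly_bounded 0 (\<lambda>_. 1)"
    unfolding poly_bounded_def by (intro exI[of _ 1]) simp
  have "lam * ((\<integral>d. d \<partial>\<delta>) - (\<integral>w. w \<partial>\<omega>)) = (\<integral>w. 1 \<partial>\<omega>) - 1 * (\<integral>d. exp (- lam * d) \<partial>\<delta>)"
    by (rule workload_balance[OF DERIV_ident pb, of 1]) (use assms in auto)
  moreover have "(\<integral>d. d \<partial>\<delta>) = (\<integral>w. w \<partial>\<omega>) + (\<integral>s. s \<partial>\<sigma>)"
  proof -
    have "integrable \<delta> (\<lambda>d. d)"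
      using sojourn_power_integrable[of 1] assms by simp
    from integral_sojourn(1)[OF this] show ?thesis
      using assms by (simp add: S.prob_space W.prob_space)
  qed
  ultimately show ?thesis
    by (simp add: W.prob_space)
qed

text \<open>Formulated for the unscaled sojourn time and a general bound \<open>B\<close>, so that
  the scaling by \<open>\<epsilon>\<close> enters only through \<open>B\<close> and through the rate
  \<open>mu * \<epsilon>\<close> of the target law.\<close>

lemma sojourn_exp_distance:
  fixes f :: "nat \<Rightarrow> real \<Rightarrow> real" and g g' :: "real \<Rightarrow> real"
  assumes mu: "0 < mu" and eps: "\<epsilon> = 1 - lam / mu" "0 < \<epsilon>" and k: "1 \<le> k"
    and f: "\<And>j x. j < k \<Longrightarrow> (f j has_real_derivative f (Suc j) x) (at x)" "\<And>x. \<bar>f k x\<bar> \<le> B"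
    and moment: "integrable \<sigma> (\<lambda>s. s ^ (k + 2))"
      "\<And>i. i \<le> k + 1 \<Longrightarrow> (\<integral>s. s ^ i \<partial>\<sigma>) = fact i / mu ^ i"
    and dens: "\<sigma> = density lborel (\<lambda>y. ennreal (g y))"
    and g: "g \<in> borel_measurable borel" "\<And>y. 0 \<le> g y" "\<And>y. y < 0 \<Longrightarrow> g y = 0"
      "\<And>y. 0 < y \<Longrightarrow> (g has_real_derivative g' y) (at y)"
    and C1: "0 \<le> C1" "(\<integral>\<^sup>+y\<in>{0<..}. ennreal \<bar>y ^ k * (g' y + mu * g y)\<bar> \<partial>lborel) \<le> ennreal C1"
  shows "\<bar>(\<integral>d. f 0 d \<partial>\<delta>) - (\<integral>z. f 0 z \<partial>exp_law (mu * \<epsilon>))\<bar>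
    \<le> B * (C1 / (mu * fact k)
        + 2 * (lam * mu / fact (k + 2) * (\<integral>s. s ^ (k + 2) \<partial>\<sigma>) + lam / mu ^ (k + 1)))"
proof -
  let ?nu = "mu * \<epsilon>"
  have nu: "0 < ?nu"
    using mu eps(2) by simp
  have k0: "0 < k"
    using k by simp
  have mean: "(\<integral>s. s \<partial>\<sigma>) = 1 / mu"
    using moment(2)[of 1] by simp
  have load: "lam * (\<integral>s. s \<partial>\<sigma>) < 1"
    using eps by (simp add: mean)
  have lam_nu: "mu = lam + ?nu"
    using mu eps(1) by (simp add: field_simps)
  have S_int: "integrable \<sigma> (\<lambda>s. s ^ i)" if "i \<le> k + 2" for i
    using integrable_power_le[OF _ service(2,3) moment(1) that] by (simp add: S.finite_measure_axioms)
  have W_int: "integrable \<omega> (\<lambda>w. w ^ (k + 1))"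
    by (rule wait_moment[OF load moment(1)])
  have W_int1: "integrable \<omega> (\<lambda>w. w)"
    using integrable_power_le[OF _ sets_wait wait_nonneg W_int, of 1] by (simp add: W.finite_measure_axioms)
  note f_meas [measurable] = measurable_tower[where u = f and j = 0, OF f(1) k0 le0]
  have f_pb: "poly_bounded k (f 0)"
    using poly_bounded_tower[where u = f, OF f, of 0] by simp
  have f_cont: "isCont (f 0) x" for x
    by (rule DERIV_isCont[OF f(1)[OF k0]])
  let ?m = "exp_average ?nu (f 0)" and ?n = "exp_average mu (f 0)"
  have m_deriv: "(?m has_real_derivative ?nu * (?m x - f 0 x)) (at x)" for x
    by (rule exp_average_has_derivative[OF nu f_pb f_cont])
  have n_deriv: "(?n has_real_derivative mu * (?n x - f 0 x)) (at x)" for x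
    by (rule exp_average_has_derivative[OF mu f_pb f_cont])
  have m_pb: "poly_bounded k ?m"
    by (rule poly_bounded_exp_average[OF nu f_pb f_meas])
  have n_pb: "poly_bounded k ?n"
    by (rule poly_bounded_exp_average[OF mu f_pb f_meas])
  have [measurable]: "?m \<in> borel_measurable borel" "?n \<in> borel_measurable borel"
    using m_deriv n_deriv
    by (auto intro!: borel_measurable_continuous_onI continuous_at_imp_continuous_on intro: DERIV_isCont)
  have "\<exists>K. \<forall>x::real. - \<infinity> < ereal x \<longrightarrow> ereal x < \<infinity> \<longrightarrow> (K has_vector_derivative ?m x) (at x)"
    by (rule einterval_antiderivative) (auto intro: DERIV_isCont[OF m_deriv])
  then obtain K where K: "\<And>x. (K has_real_derivative ?m x) (at x)"
    by (auto simp: has_real_derivative_iff_has_vector_derivative)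
  have K_pb: "poly_bounded (k + 1) K"
    using poly_bounded_antiderivative[OF m_pb K] by simp
  have [measurable]: "K \<in> borel_measurable borel"
    using K by (intro borel_measurable_continuous_onI continuous_at_imp_continuous_on) (auto intro: DERIV_isCont)

  text \<open>\<open>K\<close> and its averages over the limit law are linked by comparing the two Stein equations.\<close>
  have K_avg: "exp_average mu K x = K x + (?m x - \<epsilon> * ?n x) / lam" for x
  proof (rule exp_average_eqI[OF mu _ K_pb])
    have "poly_bounded (k + 1) (\<lambda>x. K x + (inverse lam * ?m x + (- \<epsilon> / lam) * ?n x))"
      by (intro poly_bounded_add K_pb poly_bounded_cmult poly_bounded_mono[OF m_pb] poly_bounded_mono[OF n_pb]) auto
    moreover have "(\<lambda>x. K x + (inverse lam * ?m x + (- \<epsilon> / lam) * ?n x)) = (\<lambda>x. K x + (?m x - \<epsilon> * ?n x) / lam)"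
      using lam by (auto simp: field_simps)
    ultimately show "poly_bounded (k + 1) (\<lambda>x. K x + (?m x - \<epsilon> * ?n x) / lam)"
      by simp
    show "((\<lambda>x. K x + (?m x - \<epsilon> * ?n x) / lam) has_real_derivative
        mu * (K x + (?m x - \<epsilon> * ?n x) / lam - K x)) (at x)" for x
    proof -
      have "((\<lambda>x. K x + (?m x - \<epsilon> * ?n x) / lam) has_real_derivative
          ?m x + (?nu * (?m x - f 0 x) - \<epsilon> * (mu * (?n x - f 0 x))) / lam) (at x)"
        by (intro DERIV_add K DERIV_cdivide DERIV_diff m_deriv DERIV_cmult n_deriv)
      \<comment> \<open>The weight \<open>\<epsilon>\<close> on \<open>?n\<close> makes the two
        occurrences of \<open>f 0\<close> cancel, since \<open>?nu = mu * \<epsilon>\<close>; then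
        \<open>mu - lam = ?nu\<close> recombines the \<open>?m\<close> terms.\<close>
      moreover have "?nu * (?m x - f 0 x) - \<epsilon> * (mu * (?n x - f 0 x)) = (mu - lam) * ?m x - mu * (\<epsilon> * ?n x)"
      proof -
        have *: "mu - lam = ?nu"
          using lam_nu by linarith
        show ?thesis
          unfolding * by (simp add: algebra_simps)
      qed
      ultimately show ?thesis
        using lam by (simp add: field_simps)
    qed
  qed measurable

  \<comment> \<open>The tower over \<open>K\<close>: after \<open>K\<close> come the averages of
    \<open>f 0, ..., f k\<close>, and on top the right-hand side of the equation for the average of
    \<open>f k\<close>. This reaches order \<open>k + 2\<close>, with bound
    \<open>?nu * (2 * B)\<close>.\<close>
  define \<kappa> where "\<kappa> j = (if j = 0 then K else if j \<le> k + 1 then exp_average ?nu (f (j - 1))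
      else (\<lambda>x. ?nu * (exp_average ?nu (f k) x - f k x)))" for j
  have \<kappa>_deriv: "(\<kappa> j has_real_derivative \<kappa> (Suc j) x) (at x)" if j: "j < k + 2" for j x
  proof -
    consider "j = 0" | i where "j = Suc i" "i < k" | "j = Suc k"
      using j by (cases j) (auto simp: less_Suc_eq)
    then show ?thesis
    proof cases
      case 1
      then show ?thesis
        using K by (simp add: \<kappa>_def)
    next
      case 2
      then show ?thesis
        using exp_average_tower_deriv(2)[where f = f and j = i, OF nu f] by (simp add: \<kappa>_def)
    next
      case 3
      then show ?thesis
        using exp_average_tower_deriv_top[where f = f, OF nu f k0] by (simp add: \<kappa>_def)
    qed
  qed
  have \<kappa>_bound: "\<bar>\<kappa> (k + 2) x\<bar> \<le> ?nu * (2 * B)" for x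
  proof -
    have "\<bar>exp_average ?nu (f k) x - f k x\<bar> \<le> 2 * B"
      using exp_average_abs_le[where f = "f k" and x = x, OF nu f(2)] f(2)[of x] by linarith
    then have "?nu * \<bar>exp_average ?nu (f k) x - f k x\<bar> \<le> ?nu * (2 * B)"
      using nu by (intro mult_left_mono) auto
    moreover have "\<kappa> (k + 2) x = ?nu * (exp_average ?nu (f k) x - f k x)"
      by (simp add: \<kappa>_def)
    ultimately show ?thesis
      by (simp only: abs_mult[of ?nu] abs_of_pos[OF nu])
  qed

  define a where "a w = (\<integral>s. f 0 (w + s) \<partial>\<sigma>) - ?n w" for w
  define b where "b w = (\<integral>s. K (w + s) \<partial>\<sigma>) - exp_average mu K w" for w
  let ?A = "B / fact k / mu * C1"
  \<comment> \<open>The last summand is the moment of order \<open>k + 2\<close> of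
    \<open>exp_law mu\<close>.\<close>
  let ?B = "?nu * (2 * B) / fact (k + 2) * ((\<integral>s. s ^ (k + 2) \<partial>\<sigma>) + fact (k + 2) / mu ^ (k + 2))"
  have a_bound: "\<bar>a w\<bar> \<le> ?A" for w
    unfolding a_def dens
    by (rule density_stein_bound[OF mu k f _ _ _ g C1])
      (use service(1) S_int[of k] moment(2) in \<open>simp_all add: dens\<close>)
  have b_bound: "\<bar>b w\<bar> \<le> ?B" for w
  proof -
    have "\<bar>(\<integral>s. \<kappa> 0 (w + s) \<partial>\<sigma>) - (\<integral>s. \<kappa> 0 (w + s) \<partial>exp_law mu)\<bar>
      \<le> ?nu * (2 * B) / fact (k + 2) * ((\<integral>s. s ^ (k + 2) \<partial>\<sigma>) + (\<integral>s. s ^ (k + 2) \<partial>exp_law mu))"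
      by (rule matched_moments_abs_le[OF _ \<kappa>_deriv \<kappa>_bound service moment(1)
            prob_space_exp_law[OF mu] sets_exp_law AE_exp_law_nonneg exp_law_power_moment(1)[OF mu]])
        (auto simp: moment(2) exp_law_power_moment(2)[OF mu])
    then show ?thesis
      by (simp only: exp_law_power_moment(2)[OF mu]) (simp add: b_def \<kappa>_def exp_average_def)
  qed

  have intW: "integrable \<omega> K" "integrable \<omega> ?m" "integrable \<omega> ?n"
    using wait_poly_integrable[OF K_pb _ W_int] wait_poly_integrable[OF m_pb _ W_int] wait_poly_integrable[OF n_pb _ W_int]
    by auto
  have intD: "integrable \<delta> K" "integrable \<delta> (f 0)"
    using sojourn_poly_integrable[OF K_pb _ W_int] sojourn_poly_integrable[OF f_pb _ W_int] S_int[of "k + 1"] by auto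
  have a_int: "integrable \<omega> a"
    unfolding a_def using integral_sojourn(2)[OF intD(2)] intW by auto
  have b_int: "integrable \<omega> b"
    unfolding b_def K_avg using integral_sojourn(2)[OF intD(1)] intW by auto

  have "lam * ((\<integral>d. K d \<partial>\<delta>) - (\<integral>w. K w \<partial>\<omega>)) = (\<integral>w. ?m w \<partial>\<omega>) - ?m 0 * (\<integral>d. exp (- lam * d) \<partial>\<delta>)"
    by (rule workload_balance[OF K m_pb W_int]) (use S_int[of "k + 1"] in auto)
  moreover have "(\<integral>d. exp (- lam * d) \<partial>\<delta>) = \<epsilon>"
    using sojourn_laplace[OF W_int1] S_int[of 1] by (simp add: mean eps(1))
  moreover have "lam * ((\<integral>d. K d \<partial>\<delta>) - (\<integral>w. K w \<partial>\<omega>))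
      = lam * (\<integral>w. b w \<partial>\<omega>) + ((\<integral>w. ?m w \<partial>\<omega>) - \<epsilon> * (\<integral>w. ?n w \<partial>\<omega>))"
  proof -
    have "(\<integral>d. K d \<partial>\<delta>) = (\<integral>w. b w + (K w + (?m w - \<epsilon> * ?n w) / lam) \<partial>\<omega>)"
      unfolding integral_sojourn(1)[OF intD(1)] K_avg[symmetric] b_def by simp
    also have "\<dots> = (\<integral>w. b w \<partial>\<omega>) + ((\<integral>w. K w \<partial>\<omega>) + ((\<integral>w. ?m w \<partial>\<omega>) - \<epsilon> * (\<integral>w. ?n w \<partial>\<omega>)) / lam)"
      using intW b_int by simp
    finally show ?thesis
      using lam by (simp add: field_simps)
  qed
  \<comment> \<open>The integrals of \<open>?m\<close> cancel. What is left involves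
    \<open>?m 0\<close>, the expectation of \<open>f 0\<close> under the target law
    \<open>exp_law ?nu\<close>.\<close>
  ultimately have "lam * (\<integral>w. b w \<partial>\<omega>) - \<epsilon> * (\<integral>w. ?n w \<partial>\<omega>) = - ?m 0 * \<epsilon>"
    by simp
  then have n_eq: "(\<integral>w. ?n w \<partial>\<omega>) = ?m 0 + lam / \<epsilon> * (\<integral>w. b w \<partial>\<omega>)"
    using eps(2) by (simp add: field_simps)
  have triangle: "\<bar>x\<bar> \<le> A + A'" if "x = y + y'" "\<bar>y\<bar> \<le> A" "\<bar>y'\<bar> \<le> A'" for x y y' A A' :: real
    using that by linarith
  have const: "(\<integral>w. c \<partial>\<omega>) = c" for c :: real
    by (simp add: W.prob_space)
  have "(\<integral>d. f 0 d \<partial>\<delta>) = (\<integral>w. a w + ?n w \<partial>\<omega>)"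
    unfolding integral_sojourn(1)[OF intD(2)] a_def by simp
  also have "\<dots> = (\<integral>w. a w \<partial>\<omega>) + (?m 0 + lam / \<epsilon> * (\<integral>w. b w \<partial>\<omega>))"
    using a_int intW n_eq by simp
  finally have "(\<integral>d. f 0 d \<partial>\<delta>) - (\<integral>z. f 0 z \<partial>exp_law ?nu) = (\<integral>w. a w \<partial>\<omega>) + lam / \<epsilon> * (\<integral>w. b w \<partial>\<omega>)"
    by (simp add: exp_average_def)
  moreover have "\<bar>\<integral>w. a w \<partial>\<omega>\<bar> \<le> (\<integral>w. ?A \<partial>\<omega>)"
    by (rule integral_abs_bound[THEN order_trans], rule integral_mono) (use a_int a_bound in auto)
  moreover have "\<bar>\<integral>w. b w \<partial>\<omega>\<bar> \<le> (\<integral>w. ?B \<partial>\<omega>)"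
    by (rule integral_abs_bound[THEN order_trans], rule integral_mono) (use b_int b_bound in auto)
  then have "\<bar>lam / \<epsilon> * (\<integral>w. b w \<partial>\<omega>)\<bar> \<le> lam / \<epsilon> * ?B"
    unfolding const using lam eps(2) by (simp only: abs_mult abs_of_pos divide_pos_pos mult_left_mono less_imp_le)
  ultimately have "\<bar>(\<integral>d. f 0 d \<partial>\<delta>) - (\<integral>z. f 0 z \<partial>exp_law ?nu)\<bar> \<le> ?A + lam / \<epsilon> * ?B"
    unfolding const by (rule triangle)
  \<comment> \<open>The \<open>\<epsilon>\<close> inside \<open>?nu\<close> cancels the denominator,
    and the factorial of the exponential moment cancels that of the Taylor remainder.\<close>
  also have "lam / \<epsilon> * ?B = B * (2 * (lam * mu / fact (k + 2) * (\<integral>s. s ^ (k + 2) \<partial>\<sigma>) + lam / mu ^ (k + 1)))"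
  proof -
    have *: "lam / \<epsilon> * (mu * \<epsilon> * (2 * B) / F * (I + F / (mu * M))) = B * (2 * (lam * mu / F * I + lam / M))"
      if "F \<noteq> 0" "M \<noteq> 0" for F I M :: real
      using that eps(2) mu by (simp add: field_simps)
    show ?thesis
      using *[of "fact (k + 2)" "mu ^ (k + 1)"] mu by simp
  qed
  also have "?A + B * (2 * (lam * mu / fact (k + 2) * (\<integral>s. s ^ (k + 2) \<partial>\<sigma>) + lam / mu ^ (k + 1)))
      = B * (C1 / (mu * fact k) + 2 * (lam * mu / fact (k + 2) * (\<integral>s. s ^ (k + 2) \<partial>\<sigma>) + lam / mu ^ (k + 1)))"
    using mu by (simp add: field_simps)
  finally show ?thesis .
qed

end

section \<open>From the queue to its stationary law\<close>

lemma sojourn_time_0: "sojourn_time T S 0 x = S 0 x"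
  by (simp add: sojourn_time_def fcfs_sojourn_def)

lemma sojourn_time_Suc:
  "sojourn_time T S (Suc n) x = max 0 (sojourn_time T S n x - T (Suc n) x) + S (Suc n) x"
  by (simp add: sojourn_time_def fcfs_sojourn_eq[of _ _ "Suc n"] fcfs_waiting_Suc arrival_time_def)

lemma sojourn_time_cong:
  assumes "\<And>i. i \<le> n \<Longrightarrow> T i x = T' i y" "\<And>i. i \<le> n \<Longrightarrow> S i x = S' i y"
  shows "sojourn_time T S n x = sojourn_time T' S' n y"
  using assms by (induction n) (auto simp: sojourn_time_0 sojourn_time_Suc)

lemma measurable_sojourn_time:
  assumes "\<And>i. i \<le> n \<Longrightarrow> T i \<in> borel_measurable M" "\<And>i. i \<le> n \<Longrightarrow> S i \<in> borel_measurable M"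
  shows "sojourn_time T S n \<in> borel_measurable M"
  using assms
proof (induction n)
  case 0
  then show ?case
    by (simp add: sojourn_time_0[abs_def])
next
  case (Suc n)
  have [measurable]: "sojourn_time T S n \<in> borel_measurable M" "T (Suc n) \<in> borel_measurable M" "S (Suc n) \<in> borel_measurable M"
    using Suc by auto
  have "sojourn_time T S (Suc n) = (\<lambda>x. max 0 (sojourn_time T S n x - T (Suc n) x) + S (Suc n) x)"
    by (auto simp: sojourn_time_Suc)
  then show ?case
    by simp
qed

lemma (in prob_space) indep_var_of_coordinates:
  assumes V: "indep_vars (\<lambda>_. borel) V UNIV" and j: "j \<notin> A"
    and Y: "Y \<in> borel_measurable (PiM A (\<lambda>_. borel))"
  shows "indep_var borel (\<lambda>x. Y (restrict (\<lambda>i. V i x) A)) borel (V j)"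
proof -
  have "indep_var borel (Y \<circ> (\<lambda>x. restrict (\<lambda>i. V i x) A)) borel ((\<lambda>v. v j) \<circ> (\<lambda>x. restrict (\<lambda>i. V i x) {j}))"
    using j Y by (intro indep_var_compose[OF indep_var_restrict[OF V]]) auto
  then show ?thesis
    by (simp add: comp_def)
qed

lemma distr_borel_eq_exp_law:
  assumes "distributed M lborel X (exponential_density nu)"
  shows "distr M borel X = exp_law nu"
  using distributed_distr_eq_density[OF assms] distr_cong[of M M borel lborel X X]
  by (simp add: exp_law_def)

context mg1_queue
begin

lemma interarrival_measurable: "T n \<in> borel_measurable M"
  using distributed_measurable[OF interarrival[of n]] by simp

lemma sojourn_measurable: "sojourn_time T S n \<in> borel_measurable M"
  by (intro measurable_sojourn_time interarrival_measurable service_measurable)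

lemma waiting_measurable: "(\<lambda>x. max 0 (sojourn_time T S n x - T m x)) \<in> borel_measurable M"
proof -
  note [measurable] = sojourn_measurable interarrival_measurable
  show ?thesis
    by measurable
qed

lemma sojourn_indep_interarrival:
  "indep_var borel (sojourn_time T S n) borel (T (Suc n))"
proof -
  let ?A = "Inl ` {..n} \<union> Inr ` {..n} :: (nat + nat) set"
  \<comment> \<open>The same recursion fed with coordinate projections exhibits the sojourn time as
    a measurable function of the block \<open>?A\<close>, which omits the next interarrival
    time.\<close>
  let ?Y = "sojourn_time (\<lambda>i v. v (Inl i)) (\<lambda>i v. v (Inr i)) n"
  have "?Y \<in> borel_measurable (PiM ?A (\<lambda>_. borel))"
    by (intro measurable_sojourn_time measurable_component_singleton) auto
  then have "indep_var borel (\<lambda>x. ?Y (restrict (\<lambda>i. case_sum T S i x) ?A)) borel (case_sum T S (Inl (Suc n)))"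
    by (intro indep_var_of_coordinates[OF independent]) auto
  moreover have "?Y (restrict (\<lambda>i. case_sum T S i x) ?A) = sojourn_time T S n x" for x
    by (intro sojourn_time_cong) auto
  ultimately show ?thesis
    by simp
qed

lemma waiting_indep_service:
  "indep_var borel (\<lambda>x. max 0 (sojourn_time T S n x - T (Suc n) x)) borel (S (Suc n))"
proof -
  let ?A = "Inl ` {..Suc n} \<union> Inr ` {..n} :: (nat + nat) set"
  let ?D = "sojourn_time (\<lambda>i v. v (Inl i)) (\<lambda>i v. v (Inr i)) n"
  let ?Y = "\<lambda>v. max 0 (?D v - v (Inl (Suc n)))"
  have [measurable]: "?D \<in> borel_measurable (PiM ?A (\<lambda>_. borel))"
    "(\<lambda>v. v (Inl (Suc n))) \<in> borel_measurable (PiM ?A (\<lambda>_. borel))"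
    by (intro measurable_sojourn_time measurable_component_singleton; auto)+
  have "?Y \<in> borel_measurable (PiM ?A (\<lambda>_. borel))"
    by measurable
  then have "indep_var borel (\<lambda>x. ?Y (restrict (\<lambda>i. case_sum T S i x) ?A)) borel (case_sum T S (Inr (Suc n)))"
    by (intro indep_var_of_coordinates[OF independent]) auto
  moreover have "?D (restrict (\<lambda>i. case_sum T S i x) ?A) = sojourn_time T S n x" for x
    by (intro sojourn_time_cong) auto
  ultimately show ?thesis
    by simp
qed

lemma char_sojourn_Suc:
  "char (distr M borel (sojourn_time T S (Suc n))) u
    = char (distr M borel (\<lambda>x. max 0 (sojourn_time T S n x - T (Suc n) x))) u * char (distr M borel (S 0)) u"
  using char_distr_add[OF waiting_indep_service[of n], of u]
  by (simp add: sojourn_time_Suc[abs_def] service_identical[of "Suc n"])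

end

section \<open>Passage to the weak limit by characteristic functions\<close>

lemma char_reflected:
  assumes "real_distribution \<delta>" and lam: "0 < lam"
  shows "char (distr (\<delta> \<Otimes>\<^sub>M exp_law lam) borel (\<lambda>(d, t). max 0 (d - t))) u
    = (\<integral>d. \<integral>t. iexp (u * max 0 (d - t)) \<partial>exp_law lam \<partial>\<delta>)"
proof -
  interpret \<delta>: real_distribution \<delta> by fact
  interpret T: prob_space "exp_law lam"
    by (rule prob_space_exp_law[OF lam])
  interpret DT: pair_prob_space \<delta> "exp_law lam" ..
  have "integrable (\<delta> \<Otimes>\<^sub>M exp_law lam) (\<lambda>p. iexp (u * max 0 (fst p - snd p)))"
    by (rule DT.P.integrable_const_bound[where B = 1]) auto
  from DT.integral_fst'[OF this] show ?thesis
    unfolding char_def by (subst integral_distr) (auto simp: case_prod_beta)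
qed

lemma char_sum_of_pair:
  assumes "real_distribution \<omega>" "real_distribution \<sigma>"
  shows "char (distr (\<omega> \<Otimes>\<^sub>M \<sigma>) borel (\<lambda>(w, s). w + s)) u = char \<omega> u * char \<sigma> u"
proof -
  interpret W: real_distribution \<omega> by fact
  interpret S: real_distribution \<sigma> by fact
  interpret WS: pair_prob_space \<omega> \<sigma> ..
  have int: "integrable (\<omega> \<Otimes>\<^sub>M \<sigma>) (\<lambda>p. iexp (u * (fst p + snd p)))"
    by (rule WS.P.integrable_const_bound[where B = 1]) auto
  have "char (distr (\<omega> \<Otimes>\<^sub>M \<sigma>) borel (\<lambda>(w, s). w + s)) u = (\<integral>p. iexp (u * (fst p + snd p)) \<partial>(\<omega> \<Otimes>\<^sub>M \<sigma>))"
    unfolding char_def by (subst integral_distr) (auto simp: case_prod_beta)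
  also have "\<dots> = (\<integral>w. \<integral>s. iexp (u * w) * iexp (u * s) \<partial>\<sigma> \<partial>\<omega>)"
    using WS.integral_fst'[OF int] by (simp add: distrib_left exp_add[symmetric])
  also have "\<dots> = char \<omega> u * char \<sigma> u"
    by (simp add: char_def)
  finally show ?thesis .
qed

text \<open>Continuity of this bounded function is what lets weak convergence of the sojourn laws
  act on the characteristic functions of the waiting times.\<close>

lemma continuous_reflected_average:
  assumes lam: "0 < lam"
  shows "isCont (\<lambda>d. \<integral>t. iexp (u * max 0 (d - t)) \<partial>exp_law lam) x"
proof -
  interpret T: prob_space "exp_law lam"
    by (rule prob_space_exp_law[OF lam])
  have "continuous_on UNIV (\<lambda>d. \<integral>t. iexp (u * max 0 (d - t)) \<partial>exp_law lam)"
    unfolding continuous_on_sequentially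
  proof (intro allI ballI impI)
    fix X :: "nat \<Rightarrow> real" and d :: real
    assume "d \<in> UNIV" "(\<forall>n. X n \<in> UNIV) \<and> X \<longlonglongrightarrow> d"
    then have X: "X \<longlonglongrightarrow> d"
      by simp
    show "((\<lambda>d. \<integral>t. iexp (u * max 0 (d - t)) \<partial>exp_law lam) \<circ> X) \<longlonglongrightarrow> (\<integral>t. iexp (u * max 0 (d - t)) \<partial>exp_law lam)"
      unfolding comp_def
    proof (rule integral_dominated_convergence[where w = "\<lambda>_. 1"])
      show "AE t in exp_law lam. (\<lambda>n. iexp (u * max 0 (X n - t))) \<longlonglongrightarrow> iexp (u * max 0 (d - t))"
        by (intro AE_I2 tendsto_intros X)
    qed auto
  qed
  then show ?thesis
    by (simp add: continuous_on_eq_continuous_at)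
qed

text \<open>Each sojourn law is a fixed transformation of the preceding one. In terms of
  characteristic functions it is the integral of a bounded continuous function times the factor of
  the service law, so it passes to the weak limit; Levy uniqueness then turns the limit relation
  into an equation between laws.\<close>

lemma (in mg1_queue) steady_state_law:
  assumes "steady_state_sojourn M T S N D"
  defines "\<delta> \<equiv> distr N borel D"
  shows "steady_state lam (distr M borel (S 0)) \<delta> (distr (\<delta> \<Otimes>\<^sub>M exp_law lam) borel (\<lambda>(d, t). max 0 (d - t)))"
proof -
  let ?\<sigma> = "distr M borel (S 0)"
  let ?\<omega> = "distr (\<delta> \<Otimes>\<^sub>M exp_law lam) borel (\<lambda>(d, t). max 0 (d - t))"
  let ?\<delta> = "\<lambda>n. distr M borel (sojourn_time T S n)"
  interpret N: prob_space N
    using assms by (simp add: steady_state_sojourn_def)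
  have D [measurable]: "D \<in> borel_measurable N"
    using assms by (simp add: steady_state_sojourn_def)
  note [measurable] = sojourn_measurable interarrival_measurable service_measurable waiting_measurable
  have \<delta>_prob: "prob_space \<delta>"
    unfolding \<delta>_def by (rule N.prob_space_distr) measurable
  have \<delta>_rd: "real_distribution \<delta>"
    using \<delta>_prob by (auto simp: \<delta>_def real_distribution_def real_distribution_axioms_def)
  have \<delta>n_rd: "real_distribution (?\<delta> n)" for n
    using prob_space_distr[OF sojourn_measurable] by (auto simp: real_distribution_def real_distribution_axioms_def)
  have \<sigma>_rd: "real_distribution ?\<sigma>"
    using prob_space_distr[OF service_measurable] by (auto simp: real_distribution_def real_distribution_axioms_def)
  interpret \<delta>: real_distribution \<delta> by (rule \<delta>_rd)
  interpret E: prob_space "exp_law lam"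
    by (rule prob_space_exp_law[OF lam_pos])
  interpret \<delta>E: pair_prob_space \<delta> "exp_law lam" ..
  have \<omega>_prob: "prob_space ?\<omega>"
    by (rule \<delta>E.prob_space_distr) measurable
  have \<omega>_rd: "real_distribution ?\<omega>"
    using \<omega>_prob by (auto simp: real_distribution_def real_distribution_axioms_def)
  interpret \<omega>: prob_space ?\<omega> by (rule \<omega>_prob)
  interpret \<sigma>: prob_space ?\<sigma>
    by (rule prob_space_distr) measurable
  interpret \<omega>\<sigma>: pair_prob_space ?\<omega> ?\<sigma> ..
  have conv_prob: "prob_space (distr (?\<omega> \<Otimes>\<^sub>M ?\<sigma>) borel (\<lambda>(w, s). w + s))"
    by (rule \<omega>\<sigma>.prob_space_distr) measurable
  have conv: "weak_conv_m ?\<delta> \<delta>"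
    using assms by (simp add: steady_state_sojourn_def)
  \<comment> \<open>By independence this is the transformation that defines \<open>?\<omega>\<close>
    from \<open>\<delta>\<close>, applied to \<open>?\<delta> n\<close>.\<close>
  have wait_law: "distr M borel (\<lambda>x. max 0 (sojourn_time T S n x - T (Suc n) x))
      = distr (?\<delta> n \<Otimes>\<^sub>M exp_law lam) borel (\<lambda>(d, t). max 0 (d - t))" for n
  proof -
    have "?\<delta> n \<Otimes>\<^sub>M exp_law lam = distr M (borel \<Otimes>\<^sub>M borel) (\<lambda>x. (sojourn_time T S n x, T (Suc n) x))"
      using sojourn_indep_interarrival[of n] unfolding indep_var_distribution_eq
      by (simp add: distr_borel_eq_exp_law[OF interarrival])
    then show ?thesis
      by (simp add: distr_distr comp_def)
  qed
  have "char \<delta> = char (distr (?\<omega> \<Otimes>\<^sub>M ?\<sigma>) borel (\<lambda>(w, s). w + s))"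
  proof
    fix u
    let ?B = "\<lambda>d. \<integral>t. iexp (u * max 0 (d - t)) \<partial>exp_law lam"
    have B_bound: "norm (?B d) \<le> 1" for d
    proof -
      have "norm (?B d) \<le> (\<integral>t. norm (iexp (u * max 0 (d - t))) \<partial>exp_law lam)"
        by (rule integral_norm_bound)
      then show ?thesis
        using E.prob_space by simp
    qed
    have "(\<lambda>n. (\<integral>d. ?B d \<partial>?\<delta> n) * char ?\<sigma> u) \<longlonglongrightarrow> (\<integral>d. ?B d \<partial>\<delta>) * char ?\<sigma> u"
      by (intro tendsto_intros weak_conv_imp_integral_bdd_continuous_conv[OF \<delta>n_rd \<delta>_rd conv _ B_bound]
          continuous_reflected_average lam_pos)
    moreover have "char (?\<delta> (Suc n)) u = (\<integral>d. ?B d \<partial>?\<delta> n) * char ?\<sigma> u" for n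
      unfolding char_sojourn_Suc wait_law char_reflected[OF \<delta>n_rd lam_pos] ..
    ultimately have "(\<lambda>n. char (?\<delta> (Suc n)) u) \<longlonglongrightarrow> (\<integral>d. ?B d \<partial>\<delta>) * char ?\<sigma> u"
      by simp
    moreover have "(\<lambda>n. char (?\<delta> (Suc n)) u) \<longlonglongrightarrow> char \<delta> u"
      using levy_continuity1[OF \<delta>n_rd \<delta>_rd conv] by (rule LIMSEQ_Suc)
    ultimately have "char \<delta> u = (\<integral>d. ?B d \<partial>\<delta>) * char ?\<sigma> u"
      using LIMSEQ_unique by blast
    then show "char \<delta> u = char (distr (?\<omega> \<Otimes>\<^sub>M ?\<sigma>) borel (\<lambda>(w, s). w + s)) u"
      unfolding char_sum_of_pair[OF \<omega>_rd \<sigma>_rd] char_reflected[OF \<delta>_rd lam_pos] .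
  qed
  then have eq: "\<delta> = distr (?\<omega> \<Otimes>\<^sub>M ?\<sigma>) borel (\<lambda>(w, s). w + s)"
    using \<delta>_rd conv_prob
    by (intro Levy_uniqueness) (auto simp: real_distribution_def real_distribution_axioms_def)
  show ?thesis
  proof (rule steady_state.intro)
    show "AE s in ?\<sigma>. 0 \<le> s"
      using service_nonneg[of 0] by (subst AE_distr_iff) auto
    show "prob_space \<delta>" "prob_space ?\<sigma>"
      by (rule \<delta>_prob, rule \<sigma>.prob_space_axioms)
  qed (use lam_pos eq in \<open>auto simp: \<delta>_def\<close>)
qed

section \<open>The constants, the rescaling and the final estimate\<close>

lemma dcoeff_bounds:
  assumes "2 \<le> k" "1 \<le> j" "j \<le> 2 ^ (k - 1)"
  shows "3 \<le> dcoeff k j \<and> dcoeff k j \<le> k + 2"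
  using assms
proof (induction j arbitrary: k rule: less_induct)
  case (less j)
  show ?case
  proof (cases "j \<le> 2")
    case True
    then have "j = 1 \<or> j = 2"
      using less.prems by auto
    then show ?thesis
      using less.prems by (auto simp: dcoeff.simps)
  next
    case False
    define m where "m = floor_log (j - 1)"
    have j: "2 ^ m \<le> j - 1" "j - 1 < 2 * 2 ^ m"
      using False floor_log_exp2_le[of "j - 1"] floor_log_exp2_gt[of "j - 1"] by (auto simp: m_def)
    have m: "1 \<le> m"
      using j(2) False by (cases m) auto
    \<comment> \<open>Strict because \<open>2 ^ m \<le> j - 1\<close>. The recursive call therefore
      has first argument \<open>m + 1 < k\<close>, whose upper bound is even smaller.\<close>
    have "(2::nat) ^ m < 2 ^ (k - 1)"
      using j less.prems False by linarith
    then have mk: "m < k - 1"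
      by (rule power_less_imp_less_exp[rotated]) simp
    have "3 \<le> dcoeff (m + 1) (j - 2 ^ m) \<and> dcoeff (m + 1) (j - 2 ^ m) \<le> (m + 1) + 2"
      using j m False by (intro less.IH) auto
    moreover have "dcoeff k j = dcoeff (m + 1) (j - 2 ^ m)"
      using False by (subst dcoeff.simps) (simp add: m_def Let_def)
    ultimately show ?thesis
      using mk by linarith
  qed
qed

text \<open>Only the terms \<open>j = 1, 2\<close> of the constant are needed; the two cases of the definition give the same pair.\<close>

lemma first_coefficients:
  assumes "2 \<le> k"
  shows "ennreal (bcoeff lam mu k 1) * I (dcoeff k 1) + ennreal (bcoeff lam mu k 2) * I (dcoeff k 2)
    = ennreal (lam * mu / fact (k + 2)) * I (k + 2) + ennreal (lam / (6 * mu ^ (k - 2))) * I (3::nat)"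
proof (cases "k = 2")
  case True
  have "fact 4 = (24::real)"
    by (simp add: fact_numeral)
  then show ?thesis
    using True by (simp add: bcoeff_base dcoeff_base add.commute del: One_nat_def)
next
  case False
  then show ?thesis
    using assms by (simp add: bcoeff_base dcoeff_base del: One_nat_def)
qed

text \<open>If \<open>Z\<close> has rate \<open>mu\<close>, then \<open>Z / \<epsilon>\<close> has
  rate \<open>mu * \<epsilon>\<close>; this undoes the scaling of the test function on the
  exponential side.\<close>

lemma exp_law_scale:
  fixes h :: "real \<Rightarrow> real"
  assumes [measurable]: "h \<in> borel_measurable borel" and pos: "0 < mu" "0 < \<epsilon>"
  shows "(\<integral>z. h (\<epsilon> * z) \<partial>exp_law (mu * \<epsilon>)) = (\<integral>z. h z \<partial>exp_law mu)"
proof -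
  have "(\<integral>z. exponential_density mu z * h z \<partial>lborel)
      = \<bar>\<epsilon>\<bar> *\<^sub>R (\<integral>z. exponential_density mu (0 + \<epsilon> * z) * h (0 + \<epsilon> * z) \<partial>lborel)"
    by (rule lborel_integral_real_affine) (use pos in simp)
  also have "\<dots> = (\<integral>z. \<epsilon> * (exponential_density mu (\<epsilon> * z) * h (\<epsilon> * z)) \<partial>lborel)"
    using pos by simp
  also have "\<dots> = (\<integral>z. exponential_density (mu * \<epsilon>) z * h (\<epsilon> * z) \<partial>lborel)"
    using pos by (intro Bochner_Integration.integral_cong)
      (auto simp: exponential_density_def mult_less_0_iff mult_ac)
  finally show ?thesis
    using pos by (simp add: integral_exp_law_eq)
qed

theorem theorem1:
  fixes M :: "'a measure" and N :: "'b measure" and P :: "'c measure"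
    and T S :: "nat \<Rightarrow> 'a \<Rightarrow> real" and D :: "'b \<Rightarrow> real" and Z :: "'c \<Rightarrow> real"
    and lam mu \<rho> \<epsilon> C1 :: real and g :: "real \<Rightarrow> real" and k :: nat and C2 :: ennreal
  assumes k: "2 \<le> k"
    and queue: "mg1_queue M lam T S"
    and load: "\<rho> = lam * (\<integral>x. S 0 x \<partial>M)" "\<rho> < 1"
    and slack: "\<epsilon> = 1 - \<rho>"
    and D: "steady_state_sojourn M T S N D"
    and mu: "0 < mu"
    and Z: "prob_space P" "distributed P lborel Z (exponential_density mu)"
    and density: "distributed M lborel (S 0) (\<lambda>y. ennreal (g y))"
    and g_nonneg: "\<And>y. 0 \<le> g y"
    and g_support: "\<And>y. y < 0 \<Longrightarrow> g y = 0"
    and g_differentiable: "\<And>y. 0 < y \<Longrightarrow> g differentiable (at y)"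
    and g_lim: "(g \<longlongrightarrow> 0) at_top"
    and C1: "0 \<le> C1"
      "(\<integral>\<^sup>+y\<in>{0<..}. ennreal \<bar>y ^ k * (deriv g y + mu * g y)\<bar> \<partial>lborel) \<le> ennreal C1"
    and moments: "\<And>i. 1 \<le> i \<Longrightarrow> i \<le> k + 1 \<Longrightarrow> (\<integral>x. S 0 x ^ i \<partial>M) = (\<integral>z. Z z ^ i \<partial>P)"
    and C2: "C2 = ennreal (1 / (mu * fact k) * C1)
      + 2 * (\<Sum>j=1..2 ^ (k - 1). ennreal (bcoeff lam mu k j)
          * (\<integral>\<^sup>+s\<in>{0..}. ennreal (s ^ dcoeff k j) \<partial>(distr M borel (S 0))))"
  shows "(\<forall>j\<in>{1..2 ^ (k - 1)}. 3 \<le> dcoeff k j \<and> dcoeff k j \<le> k + 2)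
    \<and> zolotarev_dist k N (\<lambda>x. \<epsilon> * D x) P Z \<le> C2 * ennreal (\<epsilon> ^ k)"
proof
  show "\<forall>j\<in>{1..2 ^ (k - 1)}. 3 \<le> dcoeff k j \<and> dcoeff k j \<le> k + 2"
    using dcoeff_bounds[OF k] by simp
  interpret mg1_queue M lam T S
    by (rule queue)
  interpret P: prob_space P
    by (rule Z(1))
  define \<sigma> where "\<sigma> = distr M borel (S 0)"
  define \<delta> where "\<delta> = distr N borel D"
  interpret steady_state lam \<sigma> \<delta> "distr (\<delta> \<Otimes>\<^sub>M exp_law lam) borel (\<lambda>(d, t). max 0 (d - t))"
    unfolding \<sigma>_def \<delta>_def by (rule steady_state_law[OF D])
  have [measurable]: "S 0 \<in> borel_measurable M" "D \<in> borel_measurable N"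
    using service_measurable D by (auto simp: steady_state_sojourn_def)
  have Z_law: "distr P borel Z = exp_law mu"
    by (rule distr_borel_eq_exp_law[OF Z(2)])
  have Z_meas [measurable]: "Z \<in> borel_measurable P"
    using distributed_measurable[OF Z(2)] by simp
  have moment: "(\<integral>s. s ^ i \<partial>\<sigma>) = fact i / mu ^ i" if "i \<le> k + 1" for i
  proof (cases "i = 0")
    case True
    then show ?thesis
      using S.prob_space by simp
  next
    case False
    have "(\<integral>s. s ^ i \<partial>\<sigma>) = (\<integral>z. Z z ^ i \<partial>P)"
      unfolding \<sigma>_def using False that by (subst integral_distr) (auto simp: moments)
    also have "\<dots> = (\<integral>z. z ^ i \<partial>exp_law mu)"
      unfolding Z_law[symmetric] by (subst integral_distr) auto
    finally show ?thesis
      by (simp add: exp_law_power_moment(2)[OF mu])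
  qed
  have "(\<integral>x. S 0 x \<partial>M) = (\<integral>s. s \<partial>\<sigma>)"
    unfolding \<sigma>_def by (subst integral_distr) auto
  then have eps: "\<epsilon> = 1 - lam / mu" and eps_pos: "0 < \<epsilon>"
    using moment[of 1] load slack by auto
  define I where "I d = (\<integral>\<^sup>+s\<in>{0..}. ennreal (s ^ d) \<partial>\<sigma>)" for d
  let ?b1 = "lam * mu / fact (k + 2)" and ?b2 = "lam / (6 * mu ^ (k - 2))"
  have "ennreal (1 / (mu * fact k) * C1) + 2 * (ennreal ?b1 * I (k + 2) + ennreal ?b2 * I 3)
      \<le> C2"
  proof -
    \<comment> \<open>All summands are nonnegative extended reals, so the sum over the subset
      \<open>{1, 2}\<close> is a lower bound; this subset lies in the index range because
      \<open>k \<ge> 2\<close>.\<close>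
    have "(\<Sum>j\<in>{1, 2::nat}. ennreal (bcoeff lam mu k j) * I (dcoeff k j))
        \<le> (\<Sum>j=1..2 ^ (k - 1). ennreal (bcoeff lam mu k j) * I (dcoeff k j))"
    proof (rule sum_mono2)
      show "{1, 2::nat} \<subseteq> {1..2 ^ (k - 1)}"
        using k power_increasing[of 1 "k - 1" "2::nat"] by auto
    qed auto
    moreover have "(\<Sum>j\<in>{1, 2::nat}. ennreal (bcoeff lam mu k j) * I (dcoeff k j))
        = ennreal (bcoeff lam mu k 1) * I (dcoeff k 1) + ennreal (bcoeff lam mu k 2) * I (dcoeff k 2)"
      by simp
    ultimately show ?thesis
      unfolding C2 \<sigma>_def[symmetric] I_def[symmetric] first_coefficients[OF k]
      by (intro add_left_mono mult_left_mono) auto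
  qed
  then have C2_ge: "(ennreal (1 / (mu * fact k) * C1) + 2 * (ennreal ?b1 * I (k + 2) + ennreal ?b2 * I 3)) * ennreal (\<epsilon> ^ k)
      \<le> C2 * ennreal (\<epsilon> ^ k)"
    by (rule mult_right_mono) simp
  show "zolotarev_dist k N (\<lambda>x. \<epsilon> * D x) P Z \<le> C2 * ennreal (\<epsilon> ^ k)"
  \<comment> \<open>An infinite moment makes the right-hand side infinite, since \<open>?b1\<close>
    and \<open>\<epsilon> ^ k\<close> are positive; otherwise the moment argument for the waiting
    time is available.\<close>
  proof (cases "I (k + 2) = \<infinity>")
    case True
    have "ennreal ?b1 \<noteq> 0" "ennreal (\<epsilon> ^ k) \<noteq> 0"
      using lam_pos mu eps_pos by auto
    then have "C2 * ennreal (\<epsilon> ^ k) = \<infinity>"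
      using C2_ge True by (simp add: ennreal_mult_top ennreal_top_mult top_unique)
    then show ?thesis
      by simp
  next
    case False
    have I_eq: "I d = (\<integral>\<^sup>+s. ennreal (s ^ d) \<partial>\<sigma>)" for d
      unfolding I_def
      by (rule nn_integral_cong_AE, use service(3) in eventually_elim) simp
    have fin: "integrable \<sigma> (\<lambda>s. s ^ (k + 2))"
    proof (rule integrableI_nonneg)
      show "AE s in \<sigma>. 0 \<le> s ^ (k + 2)"
        using service(3) by eventually_elim simp
      show "(\<integral>\<^sup>+s. ennreal (s ^ (k + 2)) \<partial>\<sigma>) < \<infinity>"
        using False I_eq by (simp add: less_top)
    qed measurable
    have I_int: "I d = ennreal (\<integral>s. s ^ d \<partial>\<sigma>)" if "d \<le> k + 2" for d
      unfolding I_eq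
    proof (rule nn_integral_eq_integral)
      show "integrable \<sigma> (\<lambda>s. s ^ d)"
        using integrable_power_le[OF _ service(2,3) fin that] by (simp add: S.finite_measure_axioms)
      show "AE s in \<sigma>. 0 \<le> s ^ d"
        using service(3) by eventually_elim simp
    qed
    let ?m = "\<integral>s. s ^ (k + 2) \<partial>\<sigma>"
    have m_nonneg: "0 \<le> ?m"
      by (rule integral_nonneg_AE) (use service(3) in \<open>eventually_elim, simp\<close>)
    define R where "R = C1 / (mu * fact k) + 2 * (lam * mu / fact (k + 2) * ?m + lam / mu ^ (k + 1))"
    \<comment> \<open>The remainder contributed by \<open>Z\<close> in the form \<open>?b2\<close>
      times the third service moment; the third moment is among the matched ones because
      \<open>3 \<le> k + 1\<close>.\<close>
    have b2: "?b2 * (fact 3 / mu ^ 3) = lam / mu ^ (k + 1)"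
    proof -
      have "mu ^ (k + 1) = mu ^ (k - 2) * mu ^ 3"
        using k by (simp add: power_add[symmetric])
      then show ?thesis
        by (simp add: fact_numeral)
    qed
    have "ennreal R * ennreal (\<epsilon> ^ k) \<le> C2 * ennreal (\<epsilon> ^ k)"
    proof -
      have "ennreal (1 / (mu * fact k) * C1) + 2 * (ennreal ?b1 * I (k + 2) + ennreal ?b2 * I 3) = ennreal R"
      proof -
        have "ennreal ?b1 * I (k + 2) = ennreal (?b1 * ?m)"
          unfolding I_int[OF order_refl] using lam_pos mu
          by (intro ennreal_mult[symmetric] m_nonneg) simp
        moreover have "ennreal ?b2 * I 3 = ennreal (lam / mu ^ (k + 1))"
        proof -
          have "I 3 = ennreal (fact 3 / mu ^ 3)"
            using k moment[of 3] by (subst I_int) auto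
          then show ?thesis
            unfolding b2[symmetric] using lam_pos mu by (simp only:) (intro ennreal_mult[symmetric]; simp)
        qed
        moreover have "ennreal (?b1 * ?m) + ennreal (lam / mu ^ (k + 1)) = ennreal (?b1 * ?m + lam / mu ^ (k + 1))"
          using lam_pos mu m_nonneg by (subst ennreal_plus) auto
        moreover have "2 * ennreal (?b1 * ?m + lam / mu ^ (k + 1)) = ennreal (2 * (?b1 * ?m + lam / mu ^ (k + 1)))"
          using lam_pos mu m_nonneg by (subst ennreal_mult) auto
        moreover have "ennreal (1 / (mu * fact k) * C1) + ennreal (2 * (?b1 * ?m + lam / mu ^ (k + 1))) = ennreal R"
          using lam_pos mu m_nonneg C1(1) by (subst ennreal_plus[symmetric]) (auto simp: R_def)
        ultimately show ?thesis
          by simp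
      qed
      then show ?thesis
        using C2_ge by simp
    qed
    moreover have "zolotarev_dist k N (\<lambda>x. \<epsilon> * D x) P Z \<le> ennreal R * ennreal (\<epsilon> ^ k)"
      unfolding zolotarev_dist_def
    proof (rule SUP_least)
      fix h assume h: "h \<in> zolotarev_test k"
      \<comment> \<open>The tower of the rescaled test function; the chain-rule factor
        \<open>\<epsilon> ^ j\<close> becomes the bound \<open>\<epsilon> ^ k\<close> at the
        top.\<close>
      define f where "f j x = \<epsilon> ^ j * (deriv ^^ j) h (\<epsilon> * x)" for j x
      have h_deriv: "((deriv ^^ j) h has_real_derivative (deriv ^^ Suc j) h x) (at x)" if "j < k" for j x
        using h that by (simp add: zolotarev_test_def DERIV_deriv_iff_real_differentiable)
      have f_deriv: "(f j has_real_derivative f (Suc j) x) (at x)" if "j < k" for j x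
      proof -
        have "((\<lambda>x. (deriv ^^ j) h (\<epsilon> * x)) has_real_derivative (deriv ^^ Suc j) h (\<epsilon> * x) * (\<epsilon> * 1)) (at x)"
          by (intro DERIV_chain2[OF h_deriv[OF that]] DERIV_cmult DERIV_ident)
        from DERIV_cmult[OF this, of "\<epsilon> ^ j"] show ?thesis
          by (simp add: f_def[abs_def] mult_ac)
      qed
      have f_bound: "\<bar>f k x\<bar> \<le> \<epsilon> ^ k" for x
        using h eps_pos mult_left_mono[of "\<bar>(deriv ^^ k) h (\<epsilon> * x)\<bar>" 1 "\<epsilon> ^ k"]
        by (simp add: zolotarev_test_def f_def abs_mult)
      have k0: "0 < k"
        using k by simp
      have h_cont: "isCont h x" for x
        using DERIV_isCont[OF h_deriv[OF k0]] by simp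
      have [measurable]: "h \<in> borel_measurable borel"
        using h_cont by (intro borel_measurable_continuous_onI continuous_at_imp_continuous_on) auto
      have g_meas: "g \<in> borel_measurable borel"
      \<comment> \<open>The density supplies measurability of \<open>g\<close> only after embedding
        into \<open>ennreal\<close>; nonnegativity lets \<open>enn2real\<close> undo the
        embedding.\<close>
      proof -
        have "(\<lambda>y. ennreal (g y)) \<in> borel_measurable borel"
          using distributed_borel_measurable[OF density] by simp
        then have "(\<lambda>y. enn2real (ennreal (g y))) \<in> borel_measurable borel"
          by measurable
        then show ?thesis
          using g_nonneg by simp
      qed
      have dens: "\<sigma> = density lborel (\<lambda>y. ennreal (g y))"
        using distributed_distr_eq_density[OF density] distr_cong[of M M borel lborel "S 0" "S 0"]
        by (simp add: \<sigma>_def)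
      have g_deriv: "(g has_real_derivative deriv g y) (at y)" if "0 < y" for y
        using g_differentiable[OF that] by (simp add: DERIV_deriv_iff_real_differentiable)
      have "\<bar>(\<integral>d. f 0 d \<partial>\<delta>) - (\<integral>z. f 0 z \<partial>exp_law (mu * \<epsilon>))\<bar> \<le> \<epsilon> ^ k * R"
        unfolding R_def
        by (rule sojourn_exp_distance[OF mu eps eps_pos _ f_deriv f_bound fin moment dens g_meas
              g_nonneg g_support g_deriv C1]) (use k in auto)
      moreover have "(\<integral>d. f 0 d \<partial>\<delta>) = (\<integral>x. h (\<epsilon> * D x) \<partial>N)"
        unfolding \<delta>_def f_def by (subst integral_distr) auto
      moreover have "(\<integral>z. f 0 z \<partial>exp_law (mu * \<epsilon>)) = (\<integral>z. h (Z z) \<partial>P)"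
      proof -
        have "(\<integral>z. f 0 z \<partial>exp_law (mu * \<epsilon>)) = (\<integral>z. h z \<partial>exp_law mu)"
          using exp_law_scale[of h, OF _ mu eps_pos] by (simp add: f_def)
        also have "\<dots> = (\<integral>z. h (Z z) \<partial>P)"
          unfolding Z_law[symmetric] by (subst integral_distr) auto
        finally show ?thesis .
      qed
      ultimately have "\<bar>(\<integral>x. h (\<epsilon> * D x) \<partial>N) - (\<integral>z. h (Z z) \<partial>P)\<bar> \<le> R * \<epsilon> ^ k"
        by (simp add: mult.commute)
      moreover have "0 \<le> R"
        using lam_pos mu m_nonneg C1(1) by (simp add: R_def)
      ultimately show "ennreal \<bar>(\<integral>x. h (\<epsilon> * D x) \<partial>N) - (\<integral>z. h (Z z) \<partial>P)\<bar> \<le> ennreal R * ennreal (\<epsilon> ^ k)"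
        using eps_pos by (simp add: ennreal_mult[symmetric] ennreal_leI)
    qed
    ultimately show ?thesis
      by (rule order_trans[rotated])
  qed
qed

end
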